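(* Let $\Gamma\subset\mathrm{PSL}(2,\mathbb{R})$ be a torsion-free non-uniform lattice, $S=\Gamma\backslash\mathbb{H}$, and let $(\Gamma_n)_{n\in\mathbb{N}}$ be a decreasing sequence of finite index subgroups of $\Gamma$ with $[\Gamma:\Gamma_n]\to\infty$. Let $S_n=\Gamma_n\backslash\mathbb{H}$, let $\mathcal{Y}=\varprojlim(T^1S_{n+1}\xrightarrow{\pi_n} T^1S_n)$, and let $\pi:\mathcal{Y}\to T^1S$ be the projection. Let $x\in T^1S$ be a periodic point for the horocycle flow, associated to a cusp $\xi$ of $S$. For each $n$, let $c_n$ be the number of cusps of $S_n$ which project onto the cusp $\xi$ under the covering $\Pi_n:S_n\to S$ (so $c_n\le c_{n+1}$ for all $n$). Let $\mathcal{M}=\pi^{-1}(h_{\mathbb{R}}(x))$. Then: (1) If $c_n=1$ for all $n$, then $\mathcal{M}$ is a one-dimensional solenoid that is a minimal set for the horocycle flow on $\mathcal{Y}$. (2) If $\max_{n\in\mathbb{N}}c_n=m\in\mathbb{N}$, then $\mathcal{M}$ is the disjoint union of $m$ one-dimensional solenoids that are minimal sets for the horocycle flow on $\mathcal{Y}$. (3) If $\{c_n\}$ is unbounded, then $\mathcal{M}$ is the disjoint union of infinitely many minimal sets for the horocycle flow on $\mathcal{Y}$.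
   Context: Set $\Gamma_0=\Gamma$, $S_0=S$. The groups $\Gamma_n$ need not be normal in $\Gamma$. The map $\pi_n:S_{n+1}\to S_n$ is the natural covering; the induced covering $T^1S_{n+1}=\Gamma_{n+1}\backslash\mathrm{PSL}(2,\mathbb{R})\to T^1S_n=\Gamma_n\backslash\mathrm{PSL}(2,\mathbb{R})$ is also denoted $\pi_n$; $\Pi_n$ is the natural finite covering $S_n\to S$ (composition of the first $n$ coverings of the tower). The inverse limit is $$\mathcal{Y}=\Big\{(y_n)_{n\ge 0}\in\prod_{n\ge 0}T^1S_n : \pi_n(y_{n+1})=y_n \text{ for all } n\Big\}$$ with the topology induced by the product topology, and $\pi(y)=y_0$. The (stable) horocycle flow on $T^1S_n$ is $h_s(\Gamma_n u)=\Gamma_n u\begin{pmatrix}1&s\\0&1\end{pmatrix}$, and on $\mathcal{Y}$ it is $h_s((y_n)_n)=(h_s(y_n))_n$; $h_{\mathbb{R}}(x)$ denotes the orbit of $x$. Cusps of $S_n$ are the $\Gamma_n$-orbits of points of $\partial\mathbb{H}$ fixed by parabolic elements of $\Gamma_n$ (equivalently of $\Gamma$). A point $x=\Gamma u\in T^1S$ is periodic for the horocycle flow exactly when the forward endpoint $u(+\infty)\in\partial\mathbb{H}$ of the geodesic determined by $u$ is fixed by a parabolic element of $\Gamma$; the cusp associated to $x$ is the class of $u(+\infty)$. A minimal set for a flow is a nonempty closed invariant set containing no proper nonempty closed invariant subset. A one-dimensional solenoid (1-dimensional solenoidal manifold) is a second countable locally compact Hausdorff space with an atlas of charts onto (open interval)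 $\times$ (Cantor set) whose changes of coordinates have the form $(x,t)\mapsto(a(x,t),b(t))$ with $a(\cdot,t)$ smooth. *)

theory Defs
  imports "HOL-Analysis.Analysis" "HOL-Algebra.Coset"
begin

section \<open>Quotient topologies\<close>

definition quotient_topology :: "'a topology \<Rightarrow> ('a \<Rightarrow> 'b) \<Rightarrow> 'b topology" where
  "quotient_topology X f =
     topology (\<lambda>U. U \<subseteq> f ` topspace X \<and> openin X {x \<in> topspace X. f x \<in> U})"

lemma openin_quotient_topology:
  "openin (quotient_topology X f) U \<longleftrightarrow>
     U \<subseteq> f ` topspace X \<and> openin X {x \<in> topspace X. f x \<in> U}"
proof -
  have "istopology (\<lambda>U. U \<subseteq> f ` topspace X \<and> openin X {x \<in> topspace X. f x \<in> U})"
    unfolding istopology_def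
  proof (intro conjI allI impI)
    fix S T
    assume *: "S \<subseteq> f ` topspace X \<and> openin X {x \<in> topspace X. f x \<in> S}"
              "T \<subseteq> f ` topspace X \<and> openin X {x \<in> topspace X. f x \<in> T}"
    show "S \<inter> T \<subseteq> f ` topspace X" using * by blast
    have "{x \<in> topspace X. f x \<in> S \<inter> T} =
          {x \<in> topspace X. f x \<in> S} \<inter> {x \<in> topspace X. f x \<in> T}" by blast
    then show "openin X {x \<in> topspace X. f x \<in> S \<inter> T}" 
      using openin_Int[OF conjunct2[OF *(1)] conjunct2[OF *(2)]] by (simp only:)
  next
    fix \<K>
    assume *: "\<forall>K\<in>\<K>. K \<subseteq> f ` topspace X \<and> openin X {x \<in> topspace X. f x \<in> K}"
    show "\<Union>\<K> \<subseteq> f ` topspace X" using * by blast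
    have "{x \<in> topspace X. f x \<in> \<Union>\<K>} = (\<Union>K\<in>\<K>. {x \<in> topspace X. f x \<in> K})" by blast
    then show "openin X {x \<in> topspace X. f x \<in> \<Union>\<K>}" using * by auto
  qed
  then show ?thesis by (simp add: quotient_topology_def topology_inverse')
qed

lemma topspace_quotient_topology: "topspace (quotient_topology X f) = f ` topspace X"
proof
  show "topspace (quotient_topology X f) \<subseteq> f ` topspace X"
    using openin_quotient_topology[of X f] by (meson openin_topspace)
  have "{x \<in> topspace X. f x \<in> f ` topspace X} = topspace X" by auto
  then have "openin (quotient_topology X f) (f ` topspace X)"
    by (simp add: openin_quotient_topology)
  then show "f ` topspace X \<subseteq> topspace (quotient_topology X f)"
    by (rule openin_subset)
qed

lemma quotient_map_quotient_topology: "quotient_map X (quotient_topology X f) f"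
  unfolding quotient_map_def
  by (auto simp: topspace_quotient_topology openin_quotient_topology)


section \<open>The group PSL(2,R)\<close>

text \<open>Elements of PSL(2,R) are cosets \<open>{A, - A}\<close> of matrices of determinant 1.\<close>

definition SL2R :: "(real^2^2) monoid" where
  "SL2R = \<lparr>carrier = {A. det A = 1}, mult = (**), one = mat 1\<rparr>"

definition PSL2R :: "(real^2^2) set monoid" where
  "PSL2R = SL2R Mod {mat 1, - mat 1}"

definition psl_class :: "real^2^2 \<Rightarrow> (real^2^2) set" where
  "psl_class A = {mat 1, - mat 1} #>\<^bsub>SL2R\<^esub> A"

definition PSL2R_top :: "(real^2^2) set topology" where
  "PSL2R_top = quotient_topology (top_of_set (carrier SL2R)) psl_class"

lemma psl_class_eq: "psl_class A = {A, - A}"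
proof -
  have "- mat 1 ** A = - A"
    by (simp add: vec_eq_iff matrix_matrix_mult_def mat_def UNIV_2 forall_2)
  then show ?thesis by (auto simp: psl_class_def r_coset_def SL2R_def)
qed

lemma group_SL2R: "group SL2R"
proof (rule groupI)
  fix A assume "A \<in> carrier SL2R"
  then have d: "det A = 1" by (simp add: SL2R_def)
  then have "invertible A" by (simp add: invertible_det_nz)
  then obtain B where B: "B ** A = mat 1" by (auto simp: invertible_def)
  then have "det B = 1" using d by (metis det_I det_mul mult.right_neutral)
  with B show "\<exists>B\<in>carrier SL2R. B \<otimes>\<^bsub>SL2R\<^esub> A = \<one>\<^bsub>SL2R\<^esub>" by (auto simp: SL2R_def)
qed (auto simp: SL2R_def det_mul matrix_mul_assoc)

lemma normal_SL2R: "{mat 1, - mat 1} \<lhd> SL2R"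
proof -
  interpret group SL2R by (rule group_SL2R)
  have minus: "- mat 1 ** A = - A" "A ** - mat 1 = - A" for A :: "real^2^2"
    by (auto simp: vec_eq_iff matrix_matrix_mult_def mat_def UNIV_2 forall_2)
  have det: "det (- mat 1 :: real^2^2) = 1"
    by (simp add: det_2 mat_def)
  have inv: "inv\<^bsub>SL2R\<^esub> (- mat 1) = - mat 1"
    by (rule inv_equality) (auto simp: SL2R_def det minus)
  have sub: "subgroup {mat 1, - mat 1} SL2R"
    using inv inv_one
    by (intro subgroup.intro) (auto simp: SL2R_def det minus)
  show ?thesis
    unfolding normal_def normal_axioms_def
    using sub group_SL2R
    by (auto simp: r_coset_def l_coset_def SL2R_def minus)
qed

lemma group_PSL2R: "group PSL2R"
  unfolding PSL2R_def by (rule normal.factorgroup_is_group[OF normal_SL2R])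

lemma carrier_PSL2R: "carrier PSL2R = psl_class ` {A. det A = 1}"
  by (auto simp: PSL2R_def FactGroup_def RCOSETS_def psl_class_def SL2R_def)

lemma topspace_PSL2R_top: "topspace PSL2R_top = carrier PSL2R"
  by (simp add: PSL2R_top_def topspace_quotient_topology carrier_PSL2R) (simp add: SL2R_def)

lemma mult_PSL2R:
  assumes "det A = 1" "det B = 1"
  shows "psl_class A \<otimes>\<^bsub>PSL2R\<^esub> psl_class B = psl_class (A ** B)"
  using normal.rcos_sum[OF normal_SL2R, of A B] assms
  by (simp add: PSL2R_def FactGroup_def psl_class_def SL2R_def)

text \<open>Torsion is taken in PSL(2,R), not in SL(2,R).\<close>

definition torsion_free :: "(real^2^2) set set \<Rightarrow> bool" where
  "torsion_free \<Gamma> \<longleftrightarrow>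
     (\<forall>g\<in>\<Gamma>. \<forall>k::nat. k > 0 \<and> g [^]\<^bsub>PSL2R\<^esub> k = \<one>\<^bsub>PSL2R\<^esub> \<longrightarrow> g = \<one>\<^bsub>PSL2R\<^esub>)"


section \<open>Homogeneous spaces, lattices and the horocycle flow\<close>

text \<open>The unit tangent bundle of \<open>\<Gamma>\<bslash>\<H>\<close> is the space of right cosets \<open>\<Gamma>u\<close>.\<close>

definition T1 :: "(real^2^2) set set \<Rightarrow> (real^2^2) set set topology" where
  "T1 \<Gamma> = quotient_topology PSL2R_top (\<lambda>u. \<Gamma> #>\<^bsub>PSL2R\<^esub> u)"

lemma topspace_T1: "topspace (T1 \<Gamma>) = rcosets\<^bsub>PSL2R\<^esub> \<Gamma>"
  by (auto simp: T1_def topspace_quotient_topology topspace_PSL2R_top RCOSETS_def)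

text \<open>A lattice is a discrete subgroup whose homogeneous space carries a nonzero finite Borel
  measure invariant under the action of the whole group by right translations.\<close>

definition lattice_subgroup :: "(real^2^2) set set \<Rightarrow> bool" where
  "lattice_subgroup \<Gamma> \<longleftrightarrow>
     subgroup \<Gamma> PSL2R \<and>
     subtopology PSL2R_top \<Gamma> = discrete_topology \<Gamma> \<and>
     (\<exists>\<mu>. sets \<mu> = sigma_sets (topspace (T1 \<Gamma>)) (Collect (openin (T1 \<Gamma>))) \<and>
          0 < emeasure \<mu> (topspace (T1 \<Gamma>)) \<and> emeasure \<mu> (topspace (T1 \<Gamma>)) < \<infinity> \<and>
          (\<forall>g\<in>carrier PSL2R. \<forall>B\<in>sets \<mu>.
             emeasure \<mu> ((\<lambda>x. x #>\<^bsub>PSL2R\<^esub> g) ` B) = emeasure \<mu> B))"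

definition nonuniform_lattice :: "(real^2^2) set set \<Rightarrow> bool" where
  "nonuniform_lattice \<Gamma> \<longleftrightarrow> lattice_subgroup \<Gamma> \<and> \<not> compact_space (T1 \<Gamma>)"

definition horo_elt :: "real \<Rightarrow> (real^2^2) set" where
  "horo_elt s = psl_class (vector [vector [1, s], vector [0, 1]])"

definition horocycle_flow :: "real \<Rightarrow> (real^2^2) set set \<Rightarrow> (real^2^2) set set" where
  "horocycle_flow s x = x #>\<^bsub>PSL2R\<^esub> horo_elt s"

lemma horo_elt_in_carrier: "horo_elt s \<in> carrier PSL2R"
  by (auto simp: horo_elt_def carrier_PSL2R det_2)

lemma horocycle_flow_coset:
  assumes "subgroup \<Gamma> PSL2R" "u \<in> carrier PSL2R"
  shows "horocycle_flow s (\<Gamma> #>\<^bsub>PSL2R\<^esub> u) = \<Gamma> #>\<^bsub>PSL2R\<^esub> (u \<otimes>\<^bsub>PSL2R\<^esub> horo_elt s)"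
  unfolding horocycle_flow_def
  using group.coset_mult_assoc[OF group_PSL2R subgroup.subset[OF assms(1)] assms(2) horo_elt_in_carrier] .

text \<open>The covering \<open>\<Gamma>'u \<mapsto> \<Gamma>u\<close> for subgroups \<open>\<Gamma>' \<subseteq> \<Gamma>\<close>, without a choice of representative.\<close>

definition covering :: "(real^2^2) set set \<Rightarrow> (real^2^2) set set \<Rightarrow> (real^2^2) set set" where
  "covering \<Gamma> x = \<Gamma> <#>\<^bsub>PSL2R\<^esub> x"

lemma covering_coset:
  assumes "subgroup \<Gamma> PSL2R" "subgroup \<Gamma>' PSL2R" "\<Gamma>' \<subseteq> \<Gamma>" "u \<in> carrier PSL2R"
  shows "covering \<Gamma> (\<Gamma>' #>\<^bsub>PSL2R\<^esub> u) = \<Gamma> #>\<^bsub>PSL2R\<^esub> u"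
proof -
  interpret group PSL2R by (rule group_PSL2R)
  have "\<Gamma> <#>\<^bsub>PSL2R\<^esub> \<Gamma>' = \<Gamma>"
  proof
    show "\<Gamma> <#>\<^bsub>PSL2R\<^esub> \<Gamma>' \<subseteq> \<Gamma>"
      using assms(1,3) by (auto simp: set_mult_def subgroup.m_closed)
    show "\<Gamma> \<subseteq> \<Gamma> <#>\<^bsub>PSL2R\<^esub> \<Gamma>'"
    proof
      fix g assume g: "g \<in> \<Gamma>"
      have "g = g \<otimes>\<^bsub>PSL2R\<^esub> \<one>\<^bsub>PSL2R\<^esub>"
        using subgroup.mem_carrier[OF assms(1) g] by simp
      then show "g \<in> \<Gamma> <#>\<^bsub>PSL2R\<^esub> \<Gamma>'"
        using g subgroup.one_closed[OF assms(2)] unfolding set_mult_def by blast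
    qed
  qed
  then show ?thesis
    unfolding covering_def
    using setmult_rcos_assoc[OF subgroup.subset[OF assms(1)] subgroup.subset[OF assms(2)] assms(4)]
    by simp
qed

text \<open>The inverse limit of the unit tangent bundles of a tower \<open>G 0 \<supseteq> G 1 \<supseteq> \<dots>\<close>.\<close>

definition tower_limit :: "(nat \<Rightarrow> (real^2^2) set set) \<Rightarrow> (nat \<Rightarrow> (real^2^2) set set) topology" where
  "tower_limit G =
     subtopology (product_topology (\<lambda>n. T1 (G n)) UNIV) {y. \<forall>n. covering (G n) (y (Suc n)) = y n}"

definition limit_flow ::
    "real \<Rightarrow> (nat \<Rightarrow> (real^2^2) set set) \<Rightarrow> (nat \<Rightarrow> (real^2^2) set set)" where
  "limit_flow s y = (\<lambda>n. horocycle_flow s (y n))"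

definition flow_orbit :: "(real \<Rightarrow> 'a \<Rightarrow> 'a) \<Rightarrow> 'a \<Rightarrow> 'a set" where
  "flow_orbit \<phi> x = range (\<lambda>s. \<phi> s x)"

definition flow_invariant :: "(real \<Rightarrow> 'a \<Rightarrow> 'a) \<Rightarrow> 'a set \<Rightarrow> bool" where
  "flow_invariant \<phi> A \<longleftrightarrow> (\<forall>s. \<phi> s ` A \<subseteq> A)"

definition minimal_set :: "'a topology \<Rightarrow> (real \<Rightarrow> 'a \<Rightarrow> 'a) \<Rightarrow> 'a set \<Rightarrow> bool" where
  "minimal_set X \<phi> A \<longleftrightarrow>
     A \<noteq> {} \<and> closedin X A \<and> flow_invariant \<phi> A \<and>
     (\<nexists>B. B \<subset> A \<and> B \<noteq> {} \<and> closedin X B \<and> flow_invariant \<phi> B)"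

definition horo_periodic :: "(real^2^2) set set \<Rightarrow> bool" where
  "horo_periodic x \<longleftrightarrow> (\<exists>T>0. horocycle_flow T x = x)"


section \<open>Boundary action and cusps\<close>

text \<open>The boundary of the upper half-plane is \<open>\<real> \<union> {\<infinity>}\<close>, with \<open>None\<close> as the point at infinity.\<close>

definition moebius :: "real^2^2 \<Rightarrow> real option \<Rightarrow> real option" where
  "moebius A z =
     (case z of
        None \<Rightarrow> if A$2$1 = 0 then None else Some (A$1$1 / A$2$1)
      | Some x \<Rightarrow> if A$2$1 * x + A$2$2 = 0 then None
                  else Some ((A$1$1 * x + A$1$2) / (A$2$1 * x + A$2$2)))"

definition psl_act :: "(real^2^2) set \<Rightarrow> real option \<Rightarrow> real option" where
  "psl_act g z = the_elem ((\<lambda>A. moebius A z) ` g)"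

lemma psl_act_class: "psl_act (psl_class A) z = moebius A z"
proof -
  have "moebius (- A) z = moebius A z"
  proof (cases z)
    case None
    then show ?thesis by (simp add: moebius_def)
  next
    case (Some x)
    have "(- A)$2$1 * x + (- A)$2$2 = - (A$2$1 * x + A$2$2)"
         "(- A)$1$1 * x + (- A)$1$2 = - (A$1$1 * x + A$1$2)" by simp_all
    then show ?thesis using Some
      by (simp only: moebius_def option.case neg_equal_0_iff_equal minus_divide_divide)
  qed
  then have "(\<lambda>A. moebius A z) ` psl_class A = {moebius A z}" by (simp add: psl_class_eq)
  then show ?thesis by (simp add: psl_act_def)
qed

text \<open>Identifying \<open>u\<close> with the image under \<open>u\<close> of the upward unit vector at \<open>\<i>\<close>, the geodesic
  determined by \<open>u\<close> is \<open>t \<mapsto> u \<cdot> (e\<^sup>t \<i>)\<close>; the two lemmas below show that \<open>u \<cdot> \<infinity>\<close> is its forward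
  endpoint.\<close>

definition forward_endpoint :: "(real^2^2) set \<Rightarrow> real option" where
  "forward_endpoint u = psl_act u None"

lemma forward_endpoint_finite:
  fixes A :: "real^2^2"
  assumes "A$2$1 \<noteq> 0"
  shows "forward_endpoint (psl_class A) = Some (A$1$1 / A$2$1)"
    and "((\<lambda>t::real. (of_real (A$1$1) * (of_real (exp t) * \<i>) + of_real (A$1$2)) /
                (of_real (A$2$1) * (of_real (exp t) * \<i>) + of_real (A$2$2)))
          \<longlongrightarrow> complex_of_real (A$1$1 / A$2$1)) at_top"
proof -
  show "forward_endpoint (psl_class A) = Some (A$1$1 / A$2$1)"
    using assms by (simp add: forward_endpoint_def psl_act_class moebius_def)
  have *: "((\<lambda>t::real. complex_of_real (exp (- t))) \<longlongrightarrow> 0) at_top"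
    using tendsto_of_real[OF filterlim_compose[OF exp_at_bot filterlim_uminus_at_bot_at_top],
        where 'a = complex] by simp
  have "((\<lambda>t::real. (of_real (A$1$1) * \<i> + of_real (A$1$2) * of_real (exp (- t))) /
                (of_real (A$2$1) * \<i> + of_real (A$2$2) * of_real (exp (- t))))
          \<longlongrightarrow> (of_real (A$1$1) * \<i> + of_real (A$1$2) * 0) /
               (complex_of_real (A$2$1) * \<i> + of_real (A$2$2) * 0)) at_top"
    by (intro tendsto_intros *) (use assms in auto)
  moreover have "(of_real (A$1$1) * \<i> + of_real (A$1$2) * of_real (exp (- t))) /
                (of_real (A$2$1) * \<i> + of_real (A$2$2) * of_real (exp (- t))) =
        (of_real (A$1$1) * (of_real (exp t) * \<i>) + of_real (A$1$2)) /
                (of_real (A$2$1) * (of_real (exp t) * \<i>) + complex_of_real (A$2$2))" for t :: real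
  proof -
    have e: "complex_of_real (exp t) \<noteq> 0" by simp
    have i: "complex_of_real (exp (- t)) = inverse (of_real (exp t))"
      by (simp add: exp_minus)
    have f: "a * (E * \<i>) + b = E * (a * \<i> + b * inverse E)" if "E \<noteq> 0" for a b E :: complex
      using that by (simp add: field_simps)
    show ?thesis
      unfolding i f[OF e] by (rule mult_divide_mult_cancel_left[OF e, symmetric])
  qed
  ultimately show "((\<lambda>t::real. (of_real (A$1$1) * (of_real (exp t) * \<i>) + of_real (A$1$2)) /
                (of_real (A$2$1) * (of_real (exp t) * \<i>) + of_real (A$2$2)))
          \<longlongrightarrow> complex_of_real (A$1$1 / A$2$1)) at_top"
    using assms by simp
qed

lemma forward_endpoint_infinite:
  fixes A :: "real^2^2"
  assumes "det A = 1" "A$2$1 = 0"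
  shows "forward_endpoint (psl_class A) = None"
    and "filterlim (\<lambda>t::real. (of_real (A$1$1) * (of_real (exp t) * \<i>) + of_real (A$1$2)) /
                (complex_of_real (A$2$1) * (of_real (exp t) * \<i>) + of_real (A$2$2)))
          at_infinity at_top"
proof -
  show "forward_endpoint (psl_class A) = None"
    using assms by (simp add: forward_endpoint_def psl_act_class moebius_def)
  have nz: "A$1$1 \<noteq> 0" "A$2$2 \<noteq> 0" using assms by (auto simp: det_2)
  have "filterlim (\<lambda>t::real. norm (complex_of_real (exp t))) at_top at_top"
    by (simp add: exp_at_top)
  then have e: "filterlim (\<lambda>t::real. complex_of_real (exp t)) at_infinity at_top"
    by (simp only: filterlim_at_infinity_conv_norm_at_top)
  have "filterlim (\<lambda>t::real. complex_of_real (A$1$2) / of_real (A$2$2) +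
          (of_real (A$1$1) * \<i> / of_real (A$2$2)) * of_real (exp t)) at_infinity at_top"
    by (rule tendsto_add_filterlim_at_infinity[OF tendsto_const
          tendsto_mult_filterlim_at_infinity[OF tendsto_const _ e]]) (use nz in auto)
  then show "filterlim (\<lambda>t::real. (of_real (A$1$1) * (of_real (exp t) * \<i>) + of_real (A$1$2)) /
                (complex_of_real (A$2$1) * (of_real (exp t) * \<i>) + of_real (A$2$2)))
          at_infinity at_top"
    using assms by (simp add: add_divide_distrib ac_simps)
qed

definition parabolic :: "(real^2^2) set \<Rightarrow> bool" where
  "parabolic g \<longleftrightarrow> g \<in> carrier PSL2R \<and> g \<noteq> \<one>\<^bsub>PSL2R\<^esub> \<and> (\<forall>A\<in>g. \<bar>trace A\<bar> = 2)"

definition boundary_orbit :: "(real^2^2) set set \<Rightarrow> real option \<Rightarrow> real option set" where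
  "boundary_orbit \<Gamma> z = (\<lambda>g. psl_act g z) ` \<Gamma>"

definition cusps :: "(real^2^2) set set \<Rightarrow> real option set set" where
  "cusps \<Gamma> = {boundary_orbit \<Gamma> z |z. \<exists>g\<in>\<Gamma>. parabolic g \<and> psl_act g z = z}"

text \<open>The covering \<open>\<Gamma>'\<bslash>\<H> \<rightarrow> \<Gamma>\<bslash>\<H>\<close> sends the \<open>\<Gamma>'\<close>-orbit of \<open>z\<close> to its \<open>\<Gamma>\<close>-orbit.\<close>

definition cusp_proj :: "(real^2^2) set set \<Rightarrow> real option set \<Rightarrow> real option set" where
  "cusp_proj \<Gamma> C = (\<Union>z\<in>C. boundary_orbit \<Gamma> z)"

definition cusps_over :: "(real^2^2) set set \<Rightarrow> (real^2^2) set set \<Rightarrow> real option set \<Rightarrow> real option set set" where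
  "cusps_over \<Gamma>' \<Gamma> \<xi> = {C \<in> cusps \<Gamma>'. cusp_proj \<Gamma> C = \<xi>}"


section \<open>One-dimensional solenoids\<close>

definition cantor_space :: "(nat \<Rightarrow> bool) topology" where
  "cantor_space = product_topology (\<lambda>_. discrete_topology UNIV) UNIV"

definition smooth_on_open :: "real set \<Rightarrow> (real \<Rightarrow> real) \<Rightarrow> bool" where
  "smooth_on_open W f \<longleftrightarrow> open W \<and> (\<forall>k. (deriv ^^ k) f differentiable_on W)"

definition solenoid_chart :: "'a topology \<Rightarrow> 'a set \<Rightarrow> ('a \<Rightarrow> real \<times> (nat \<Rightarrow> bool)) \<Rightarrow> bool" where
  "solenoid_chart X U \<phi> \<longleftrightarrow>
     openin X U \<and>
     (\<exists>I. open I \<and> is_interval I \<and> I \<noteq> {} \<and>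
          homeomorphic_map (subtopology X U) (prod_topology (top_of_set I) cantor_space) \<phi>)"

definition solenoid_transition ::
    "'a set \<Rightarrow> ('a \<Rightarrow> real \<times> (nat \<Rightarrow> bool)) \<Rightarrow> ('a \<Rightarrow> real \<times> (nat \<Rightarrow> bool)) \<Rightarrow> bool" where
  "solenoid_transition W \<phi> \<psi> \<longleftrightarrow>
     (\<exists>a b. (\<forall>p\<in>W. \<forall>x t. \<phi> p = (x, t) \<longrightarrow> \<psi> p = (a x t, b t)) \<and>
            (\<forall>t. smooth_on_open {x. (x, t) \<in> \<phi> ` W} (\<lambda>x. a x t)))"

definition one_dim_solenoid :: "'a topology \<Rightarrow> bool" where
  "one_dim_solenoid X \<longleftrightarrow>
     second_countable X \<and> locally_compact_space X \<and> Hausdorff_space X \<and>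
     (\<exists>\<A>. topspace X = (\<Union>(U, \<phi>)\<in>\<A>. U) \<and>
          (\<forall>(U, \<phi>)\<in>\<A>. solenoid_chart X U \<phi>) \<and>
          (\<forall>(U, \<phi>)\<in>\<A>. \<forall>(V, \<psi>)\<in>\<A>. solenoid_transition (U \<inter> V) \<phi> \<psi>))"

end

theory Submission
  imports Defs
begin

text \<open>The horocycle through \<open>x = \<Gamma>u\<close> is closed because \<open>\<Gamma>\<close> meets the unipotent group
\<open>u h\<^sub>s u\<inverse>\<close> in a nontrivial discrete, hence cyclic, group generated by \<open>p = u h\<^sub>T u\<inverse>\<close>. A point of
\<open>M\<close> is a thread of cosets \<open>G\<^sub>n \<gamma>\<^sub>n u h\<^sub>s\<close>, and so \<open>M\<close> is the suspension, with return time \<open>T\<close>, of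
right multiplication by \<open>p\<close> on the profinite space of threads in the finite sets \<open>G\<^sub>n\<bslash>\<Gamma>\<close>. The
horocycle orbits in \<open>T\<^sup>1S\<^sub>n\<close> lying over the orbit of \<open>x\<close> are the cycles of \<open>p\<close> on \<open>G\<^sub>n\<bslash>\<Gamma>\<close>.

These cycles are the cusps of \<open>S\<^sub>n\<close> over \<open>\<xi>\<close>: to a coset \<open>w\<close> belongs the set of forward endpoints
of its elements (\<open>cusp\<close>), and two points of \<open>M\<close> have the same cusp at level \<open>n\<close> exactly when their
\<open>n\<close>-th coordinates lie on one horocycle orbit (\<open>cusp_eq_iff_same_orbit\<close>). The substance of this is
that the stabilizer in \<open>\<Gamma>\<close> of the endpoint \<open>u\<infinity>\<close> is \<open>\<langle>p\<rangle>\<close> (\<open>endpoint_stabilizer\<close>): an element of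
it rescales the group of periods \<open>T\<int>\<close> by a positive factor and preserves it, so the factor
is 1 and the element is unipotent.

Call two points of \<open>M\<close> equivalent when their cusps agree at every level. An equivalence class
(\<open>component\<close>) is compact and flow invariant. It is minimal for a simple reason: the \<open>n\<close>-th coordinate
determines all earlier ones, and within a class the flow moves the \<open>n\<close>-th coordinate of any point
exactly onto that of any other, so every orbit in the class is dense in it. Hence \<open>M\<close> is
partitioned into minimal sets, and there are at least \<open>c\<^sub>n\<close> of them for every \<open>n\<close>.

If \<open>c\<close> attains its maximum at level \<open>N\<close>, the surjections between the finite sets of cusps are
bijections from \<open>N\<close> on, and the cusp at level \<open>N\<close> determines the class; this gives exactly \<open>m\<close>
classes. Moreover a point of a class may then be changed at high levels without leaving the
class: multiply by some \<open>g \<in> G\<^sub>m - G\<^sub>k\<close> with \<open>N \<le> m \<le> k\<close>, which exists because the indices are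
unbounded. So the fibre of a class over \<open>x\<close> is a compact totally disconnected metrizable space
without isolated points, that is, a Cantor set (\<open>homeomorphic_cantor_space\<close>), and the suspension
of a homeomorphism of a Cantor set is a solenoid (\<open>one_dim_solenoid_swept\<close>).\<close>

section \<open>A characterisation of the Cantor set\<close>

text \<open>Brouwer's theorem. The family \<open>\<B>\<close> cuts the space into a binary tree of nonempty clopen cells: at
stage \<open>n\<close> a cell is cut by the \<open>n\<close>-th member of \<open>\<B>\<close> if that member cuts it properly, and otherwise
by any member that does. One exists since a cell, being open, has two points and \<open>\<B>\<close> separates
them. Recording the side taken at each stage maps the space to \<open>cantor_space\<close>. Each member of \<open>\<B>\<close>
gets its turn, so the map is injective; no cell is empty, so by compactness it is surjective.\<close>

lemma homeomorphic_cantor_space: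
  assumes comp: "compact_space X" and ne: "\<exists>x. x \<in> topspace X"
    and count: "countable \<B>"
    and clopen: "\<And>b. b \<in> \<B> \<Longrightarrow> openin X b \<and> closedin X b"
    and separating: "\<And>x y. x \<in> topspace X \<Longrightarrow> y \<in> topspace X \<Longrightarrow> x \<noteq> y \<Longrightarrow> \<exists>b\<in>\<B>. (x \<in> b) \<noteq> (y \<in> b)"
    and perfect: "\<And>U x. openin X U \<Longrightarrow> x \<in> U \<Longrightarrow> \<exists>y\<in>U. y \<noteq> x"
  shows "X homeomorphic_space cantor_space"
proof -
  \<comment> \<open>The empty set is added so that an enumeration exists even for an empty family.\<close>
  define B where "B = from_nat_into (insert {} \<B>)"
  have B: "B k \<in> insert {} \<B>" for k
    unfolding B_def by (rule from_nat_into) simp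
  have op: "openin X (B k)" and cl: "closedin X (B k)" for k
    using B[of k] clopen by auto
  have sep: "\<exists>k. (x \<in> B k) \<noteq> (y \<in> B k)" if xy: "x \<in> topspace X" "y \<in> topspace X" "x \<noteq> y" for x y
  proof -
    obtain b where "b \<in> \<B>" "(x \<in> b) \<noteq> (y \<in> b)" using separating[OF xy] by blast
    moreover then obtain k where "B k = b"
      unfolding B_def using count from_nat_into_surj[of "insert {} \<B>" b] by auto
    ultimately show ?thesis by blast
  qed
  define splits where "splits C k \<longleftrightarrow> (\<exists>x\<in>C. x \<in> B k) \<and> (\<exists>x\<in>C. x \<notin> B k)" for C k
  define \<kappa> where "\<kappa> n C = (if splits C n then n else SOME k. splits C k)" for n C
  define cell where "cell x = rec_nat (topspace X)
    (\<lambda>n C. if x \<in> B (\<kappa> n C) then C \<inter> B (\<kappa> n C) else C - B (\<kappa> n C))" for x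
  \<comment> \<open>\<open>cell x n\<close> is the cell of stage \<open>n\<close> that contains \<open>x\<close>, and \<open>code x n\<close> the side of the cut
    made through it.\<close>
  define code where "code x n \<longleftrightarrow> x \<in> B (\<kappa> n (cell x n))" for x n
  have cell_0: "cell x 0 = topspace X" for x by (simp add: cell_def)
  have cell_Suc: "cell x (Suc n) = {y \<in> cell x n. (y \<in> B (\<kappa> n (cell x n))) = code x n}" for x n
    by (auto simp: cell_def code_def)
  have self: "x \<in> cell x n" if "x \<in> topspace X" for x n
    using that by (induction n) (auto simp: cell_0 cell_Suc code_def)
  have cell_open: "openin X (cell x n)" for x n
  proof (induction n)
    case (Suc n)
    have "cell x (Suc n) = cell x n \<inter> B (\<kappa> n (cell x n)) \<or>
          cell x (Suc n) = cell x n - B (\<kappa> n (cell x n))"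
      by (auto simp: cell_Suc)
    then show ?case using Suc op cl by (metis openin_Int openin_diff)
  qed (simp add: cell_0)
  have cell_sub: "cell x n \<subseteq> topspace X" for x n
    using cell_open by (rule openin_subset)
  \<comment> \<open>Both parts are needed together: the set that cuts at stage \<open>n\<close> depends on the cell.\<close>
  have cells: "(y \<in> topspace X \<and> (\<forall>i<n. code y i = code x i) \<longrightarrow> cell y n = cell x n) \<and>
      (y \<in> cell x n \<longleftrightarrow> y \<in> topspace X \<and> (\<forall>i<n. code y i = code x i))" for x y n
  proof (induction n)
    case (Suc n)
    have step: "(y \<in> B (\<kappa> n (cell x n))) = code y n"
      if "y \<in> topspace X" "\<forall>i<n. code y i = code x i"
      using Suc that unfolding code_def by simp
    have mem: "y \<in> cell x (Suc n) \<longleftrightarrow> y \<in> topspace X \<and> (\<forall>i<Suc n. code y i = code x i)"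
      unfolding cell_Suc mem_Collect_eq All_less_Suc using Suc step by blast
    moreover have "cell y (Suc n) = cell x (Suc n)"
      if "y \<in> topspace X" "\<forall>i<Suc n. code y i = code x i"
    proof -
      have "cell y n = cell x n" "code y n = code x n" using that Suc by auto
      then show ?thesis unfolding cell_Suc by simp
    qed
    ultimately show ?case by blast
  qed (simp add: cell_0)
  then have cell_mem: "y \<in> cell x n \<longleftrightarrow> y \<in> topspace X \<and> (\<forall>i<n. code y i = code x i)" for x y n
    by blast
  have cell_eq: "cell y n = cell x n" if "y \<in> topspace X" "\<forall>i<n. code y i = code x i" for x y n
    using that cells by blast
  have splits: "splits (cell x n) (\<kappa> n (cell x n))" if x: "x \<in> topspace X" for x n
  proof -
    obtain y where y: "y \<in> cell x n" "y \<noteq> x" using perfect[OF cell_open self[OF x]] by blast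
    obtain k where "(x \<in> B k) \<noteq> (y \<in> B k)"
      using sep[OF x _ y(2)[symmetric]] y(1) cell_sub by blast
    then have "splits (cell x n) k" using y self[OF x] unfolding splits_def by blast
    then show ?thesis unfolding \<kappa>_def by (auto intro: someI)
  qed
  \<comment> \<open>Every finite code occurs: each cut has points on both of its sides.\<close>
  have dense: "\<exists>x\<in>topspace X. \<forall>i<n. code x i = f i" for f :: "nat \<Rightarrow> bool" and n
  proof (induction n)
    case 0 then show ?case using ne by blast
  next
    case (Suc n)
    then obtain x where x: "x \<in> topspace X" "\<forall>i<n. code x i = f i" by blast
    obtain y where y: "y \<in> cell x n" "(y \<in> B (\<kappa> n (cell x n))) = f n"
      using splits[OF x(1), of n] unfolding splits_def by (cases "f n") auto
    have "cell y n = cell x n" using y(1) cell_mem by (intro cell_eq) blast+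
    then have "code y n = f n" using y(2) by (simp add: code_def)
    then show ?case using y(1) x(2) unfolding cell_mem by (intro bexI[of _ y]) (auto simp: less_Suc_eq)
  qed
  have inj: "inj_on code (topspace X)"
  proof (rule inj_onI, rule ccontr)
    fix x y assume xy: "x \<in> topspace X" "y \<in> topspace X" "code x = code y" "x \<noteq> y"
    obtain k where k: "(x \<in> B k) \<noteq> (y \<in> B k)" using sep xy by blast
    have y: "y \<in> cell x k" using xy cell_mem by simp
    have "splits (cell x k) k" using k y self[OF xy(1)] unfolding splits_def by blast
    then have "\<kappa> k (cell x k) = k" by (simp add: \<kappa>_def)
    moreover have "cell y k = cell x k" using xy by (intro cell_eq) auto
    ultimately have "code x k = (x \<in> B k)" "code y k = (y \<in> B k)" by (simp_all add: code_def)
    then show False using k xy(3) by simp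
  qed
  have cont: "continuous_map X cantor_space code"
    unfolding cantor_space_def continuous_map_componentwise_UNIV
  proof
    fix n
    show "continuous_map X (discrete_topology UNIV) (\<lambda>x. code x n)"
      unfolding continuous_map_def
    proof (intro conjI allI impI)
      fix U :: "bool set"
      have "{x \<in> topspace X. code x n \<in> U} = (\<Union>x\<in>{x \<in> topspace X. code x n \<in> U}. cell x (Suc n))"
        using self cell_mem by auto
      moreover have "openin X (\<Union>x\<in>{x \<in> topspace X. code x n \<in> U}. cell x (Suc n))"
        using cell_open by blast
      ultimately show "openin X {x \<in> topspace X. code x n \<in> U}"
        by simp
    qed auto
  qed
  have surj: "code ` topspace X = topspace cantor_space"
  proof -
    have "f \<in> code ` topspace X" for f
    proof -
      define C where "C n = {x \<in> topspace X. \<forall>i<n. code x i = f i}" for n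
      have "(\<Inter>n. C n) \<noteq> {}"
      proof (rule compact_space_imp_nest[OF comp])
        show "C n \<noteq> {}" for n using dense[of n f] by (auto simp: C_def)
        show "decseq C" by (auto simp: C_def decseq_def)
        show "closedin X (C n)" for n
        proof -
          have "topspace X - C n = (\<Union>x\<in>topspace X - C n. cell x n)"
            using self cell_mem by (auto simp: C_def)
          moreover have "openin X (\<Union>x\<in>topspace X - C n. cell x n)"
            using cell_open by blast
          ultimately have "openin X (topspace X - C n)"
            by simp
          moreover have "C n \<subseteq> topspace X" by (auto simp: C_def)
          ultimately show ?thesis by (simp add: closedin_def)
        qed
      qed
      then obtain x where "\<And>n. x \<in> C n" by blast
      then have "x \<in> topspace X" "code x = f" by (auto simp: C_def)
      then show ?thesis by blast
    qed
    then show ?thesis by (auto simp: cantor_space_def)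
  qed
  have "Hausdorff_space cantor_space"
    by (simp add: cantor_space_def Hausdorff_space_product_topology)
  then show ?thesis
    using continuous_imp_homeomorphic_map[OF cont comp _ surj inj] homeomorphic_map_imp_homeomorphic_space
    by blast
qed

section \<open>Second countability\<close>

text \<open>A basic open set constrains only finitely many coordinates, so over the index set of naturals an
initial segment of coordinates decides membership near a given point.\<close>

lemma openin_product_topology_initial_segment:
  fixes X :: "nat \<Rightarrow> 'a topology"
  assumes "openin (product_topology X UNIV) S" "y \<in> S"
  obtains n where "\<And>w. w \<in> topspace (product_topology X UNIV) \<Longrightarrow> (\<forall>i<n. w i = y i) \<Longrightarrow> w \<in> S"
proof -
  obtain U where U: "finite {i. U i \<noteq> topspace (X i)}" "y \<in> PiE UNIV U" "PiE UNIV U \<subseteq> S"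
    using assms unfolding openin_product_topology_alt by auto
  then obtain n where n: "\<And>i. U i \<noteq> topspace (X i) \<Longrightarrow> i < n"
    using finite_nat_set_iff_bounded by auto
  show thesis
  proof (rule that)
    fix w assume w: "w \<in> topspace (product_topology X UNIV)" "\<forall>i<n. w i = y i"
    have "w i \<in> U i" for i
    proof (cases "i < n")
      case True then show ?thesis using w U(2) by (auto simp: PiE_def Pi_def)
    next
      case False
      then have "U i = topspace (X i)" using n by blast
      then show ?thesis using w(1) by auto
    qed
    then show "w \<in> S" using U(3) by auto
  qed
qed

lemma second_countable_euclidean:
  "second_countable (euclidean :: 'a::second_countable_topology topology)"
proof -
  obtain \<B> :: "'a set set" where \<B>: "countable \<B>" "topological_basis \<B>"
    using ex_countable_basis by blast
  have "\<exists>V\<in>\<B>. x \<in> V \<and> V \<subseteq> U" if "open U" "x \<in> U" for U x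
    using topological_basisE[OF \<B>(2) that] by metis
  then show ?thesis
    unfolding second_countable_def open_openin[symmetric]
    using \<B> topological_basis_open by blast
qed

lemma second_countable_prod_topology:
  assumes "second_countable X" "second_countable Y"
  shows "second_countable (prod_topology X Y)"
proof -
  obtain \<A> where \<A>: "countable \<A>" "\<forall>V\<in>\<A>. openin X V"
      "\<forall>U x. openin X U \<and> x \<in> U \<longrightarrow> (\<exists>V\<in>\<A>. x \<in> V \<and> V \<subseteq> U)"
    using assms(1) unfolding second_countable_def by blast
  obtain \<B> where \<B>: "countable \<B>" "\<forall>V\<in>\<B>. openin Y V"
      "\<forall>U y. openin Y U \<and> y \<in> U \<longrightarrow> (\<exists>V\<in>\<B>. y \<in> V \<and> V \<subseteq> U)"
    using assms(2) unfolding second_countable_def by blast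
  show ?thesis
    unfolding second_countable_def
  proof (intro exI[of _ "(\<lambda>(V, W). V \<times> W) ` (\<A> \<times> \<B>)"] conjI allI impI)
    fix U p assume "openin (prod_topology X Y) U \<and> p \<in> U"
    then obtain V W where "openin X V" "openin Y W" "fst p \<in> V" "snd p \<in> W" "V \<times> W \<subseteq> U"
      unfolding openin_prod_topology_alt by (metis prod.collapse)
    moreover obtain V' where "V' \<in> \<A>" "fst p \<in> V'" "V' \<subseteq> V" using \<A> calculation by blast
    moreover obtain W' where "W' \<in> \<B>" "snd p \<in> W'" "W' \<subseteq> W" using \<B> calculation by blast
    ultimately have "V' \<times> W' \<in> (\<lambda>(V, W). V \<times> W) ` (\<A> \<times> \<B>)" "p \<in> V' \<times> W'" "V' \<times> W' \<subseteq> U"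
      by (auto simp: mem_Times_iff)
    then show "\<exists>V\<in>(\<lambda>(V, W). V \<times> W) ` (\<A> \<times> \<B>). p \<in> V \<and> V \<subseteq> U" by blast
  qed (use \<A> \<B> in \<open>auto simp: openin_prod_Times_iff\<close>)
qed

lemma second_countable_cantor_space: "second_countable cantor_space"
proof -
  define cylinder where "cylinder l = {f. \<forall>i<length l. f i = l ! i}" for l :: "bool list"
  have "openin cantor_space (cylinder l)" for l
  proof -
    have "cylinder l = PiE UNIV (\<lambda>i. if i < length l then {l ! i} else UNIV)"
      unfolding cylinder_def by (auto simp: PiE_def Pi_def split: if_splits)
    moreover have "finite {i. (if i < length l then {l ! i} else UNIV) \<noteq> UNIV}"
      by (rule finite_subset[of _ "{..<length l}"]) auto
    ultimately show ?thesis
      unfolding cantor_space_def by (auto simp: openin_PiE_gen)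
  qed
  moreover have "\<exists>l. x \<in> cylinder l \<and> cylinder l \<subseteq> U" if U: "openin cantor_space U" "x \<in> U" for U x
  proof -
    obtain n where n: "\<And>w. (\<forall>i<n. w i = x i) \<Longrightarrow> w \<in> U"
      using openin_product_topology_initial_segment[OF U[unfolded cantor_space_def]] by (auto simp: PiE_UNIV_domain)
    show ?thesis
      by (intro exI[of _ "map x [0..<n]"]) (auto simp: cylinder_def intro!: n)
  qed
  ultimately show ?thesis
    unfolding second_countable_def by (intro exI[of _ "range cylinder"]) auto
qed

section \<open>Suspensions of Cantor sets are solenoids\<close>

lemma smooth_on_open_translation:
  assumes "open W"
  shows "smooth_on_open W (\<lambda>x. x - a)"
proof -
  have d1: "deriv (\<lambda>x::real. x - a) = (\<lambda>x. 1)"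
    by (rule ext, rule DERIV_imp_deriv) (auto intro!: derivative_eq_intros)
  have "(deriv ^^ k) (\<lambda>x::real. 1::real) differentiable_on W" for k
  proof -
    have "(deriv ^^ k) (\<lambda>x::real. 1::real) = (\<lambda>x. if k = 0 then 1 else 0)"
      by (induction k) auto
    then show ?thesis by simp
  qed
  then have "(deriv ^^ k) (\<lambda>x. x - a) differentiable_on W" for k
    by (cases k) (auto simp: funpow_Suc_right d1 simp del: funpow.simps)
  then show ?thesis
    using assms by (simp add: smooth_on_open_def)
qed

lemma reduce_modulo_period:
  fixes s T :: real
  assumes "T > 0"
  obtains k :: int where "0 \<le> s - k * T" "s - k * T < T"
proof
  have "of_int \<lfloor>s / T\<rfloor> \<le> s / T" "s / T < of_int \<lfloor>s / T\<rfloor> + 1" by linarith+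
  then have "of_int \<lfloor>s / T\<rfloor> * T \<le> s" "s < (of_int \<lfloor>s / T\<rfloor> + 1) * T"
    unfolding pos_le_divide_eq[OF assms] pos_divide_less_eq[OF assms] .
  then show "0 \<le> s - \<lfloor>s / T\<rfloor> * T" "s - \<lfloor>s / T\<rfloor> * T < T" by (simp_all add: distrib_right)
qed

text \<open>A flow with a compact section \<open>Z\<close> to which every point of \<open>Z\<close> returns exactly at the integer
multiples of \<open>T\<close>. The set swept out by \<open>Z\<close> is then the quotient of \<open>\<real> \<times> Z\<close> by the deck group
generated by \<open>(s, z) \<mapsto> (s - T, \<phi> T z)\<close>. The axiom \<open>returns\<close> says both that \<open>\<phi> T\<close> and its inverse
preserve \<open>Z\<close> and that no intermediate time leads back to \<open>Z\<close>.\<close>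

locale periodic_suspension =
  fixes Y :: "'a topology" and \<phi> :: "real \<Rightarrow> 'a \<Rightarrow> 'a" and Z :: "'a set" and T :: real
  assumes Hausdorff: "Hausdorff_space Y"
    and flow_zero: "\<And>y. y \<in> topspace Y \<Longrightarrow> \<phi> 0 y = y"
    and flow_add: "\<And>s t y. y \<in> topspace Y \<Longrightarrow> \<phi> (s + t) y = \<phi> s (\<phi> t y)"
    and flow_cont: "continuous_map (prod_topology euclideanreal Y) Y (\<lambda>(s, y). \<phi> s y)"
    and compact_section: "compactin Y Z"
    and period_pos: "T > 0"
    and returns: "\<And>z s. z \<in> Z \<Longrightarrow> \<phi> s z \<in> Z \<longleftrightarrow> (\<exists>k::int. s = k * T)"
begin

definition cyl :: "(real \<times> 'a) topology" where
  "cyl = prod_topology euclideanreal (subtopology Y Z)"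

definition sweep :: "real \<times> 'a \<Rightarrow> 'a" where
  "sweep = (\<lambda>(s, z). \<phi> s z)"

definition swept :: "'a set" where
  "swept = sweep ` (UNIV \<times> Z)"

lemma section_subset: "Z \<subseteq> topspace Y"
  using compact_section by (rule compactin_subset_topspace)

lemma section_Int [simp]: "topspace Y \<inter> Z = Z"
  using section_subset by blast

lemma topspace_cyl [simp]: "topspace cyl = UNIV \<times> Z"
  by (simp add: cyl_def)

lemma flow_topspace: "y \<in> topspace Y \<Longrightarrow> \<phi> s y \<in> topspace Y"
  using continuous_map_funspace[OF flow_cont] by (auto simp: Pi_iff)

lemma swept_subset: "swept \<subseteq> topspace Y"
  using flow_topspace section_subset by (auto simp: swept_def sweep_def)

lemma openin_strip: "openin cyl ({a <..< b} \<times> Z)"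
proof -
  have "openin (subtopology Y Z) Z" using openin_topspace[of "subtopology Y Z"] by simp
  then show ?thesis by (simp add: cyl_def openin_prod_Times_iff)
qed

lemma continuous_sweep: "continuous_map cyl (subtopology Y swept) sweep"
proof -
  have "cyl = subtopology (prod_topology euclideanreal Y) (UNIV \<times> Z)"
    by (simp add: cyl_def prod_topology_subtopology)
  then have "continuous_map cyl Y sweep"
    unfolding sweep_def using continuous_map_from_subtopology[OF flow_cont] by simp
  then show ?thesis
    by (auto simp: continuous_map_in_subtopology swept_def)
qed

lemma sweep_eq_iff:
  assumes z: "z \<in> Z" "z' \<in> Z"
  shows "\<phi> s z = \<phi> s' z' \<longleftrightarrow> (\<exists>k::int. s' = s - k * T \<and> z' = \<phi> (k * T) z)"
proof
  note Y = subsetD[OF section_subset z(1)] subsetD[OF section_subset z(2)]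
  assume eq: "\<phi> s z = \<phi> s' z'"
  have "\<phi> (s - s') z = \<phi> (- s') (\<phi> s z)" using flow_add[OF Y(1), of "-s'" s] by simp
  also have "\<dots> = z'" using eq flow_add[OF Y(2), of "-s'" s'] flow_zero[OF Y(2)] by simp
  finally have z': "\<phi> (s - s') z = z'" .
  then obtain k :: int where "s - s' = k * T" using returns z by blast
  then have "s' = s - k * T \<and> z' = \<phi> (k * T) z" using z' by auto
  then show "\<exists>k::int. s' = s - k * T \<and> z' = \<phi> (k * T) z" ..
next
  assume "\<exists>k::int. s' = s - k * T \<and> z' = \<phi> (k * T) z"
  then obtain k :: int where k: "s' = s - k * T" "z' = \<phi> (k * T) z" by blast
  show "\<phi> s z = \<phi> s' z'"
    using flow_add[of z s' "k * T"] z(1) section_subset unfolding k by auto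
qed

lemma deck_in_section: "z \<in> Z \<Longrightarrow> \<phi> (of_int k * T) z \<in> Z"
  using returns by blast

lemma continuous_deck: "continuous_map cyl cyl (\<lambda>(s, z). (s - of_int k * T, \<phi> (of_int k * T) z))"
proof -
  have "continuous_map (subtopology Y Z) Y (\<lambda>z. (\<lambda>(s, y). \<phi> s y) (k * T, z))"
    by (rule continuous_map_compose[OF _ flow_cont, unfolded o_def])
      (auto intro!: continuous_map_pairedI continuous_map_from_subtopology)
  then have "continuous_map (subtopology Y Z) (subtopology Y Z) (\<phi> (k * T))"
    using deck_in_section by (auto simp: continuous_map_in_subtopology)
  then have "continuous_map cyl (subtopology Y Z) (\<phi> (k * T) \<circ> snd)"
    unfolding cyl_def by (rule continuous_map_compose[OF continuous_map_snd])
  moreover have "continuous_map cyl euclideanreal (\<lambda>p. fst p - k * T)"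
    unfolding cyl_def by (intro continuous_intros continuous_map_fst)
  ultimately show ?thesis
    unfolding cyl_def case_prod_unfold by (intro continuous_map_pairedI) (auto simp: o_def)
qed

lemma sweep_fundamental_domain: "sweep ` ({0..T} \<times> Z) = swept"
proof -
  have "\<exists>t z'. t \<in> {0..T} \<and> z' \<in> Z \<and> \<phi> s z = \<phi> t z'" if "z \<in> Z" for s z
  proof -
    obtain k :: int where "0 \<le> s - k * T" "s - k * T < T"
      using period_pos by (rule reduce_modulo_period)
    then have "s - k * T \<in> {0..T}" by simp
    moreover have "\<phi> s z = \<phi> (s - k * T) (\<phi> (k * T) z)"
      using sweep_eq_iff[OF that deck_in_section[OF that]] by blast
    ultimately show ?thesis using deck_in_section[OF that] by blast
  qed
  then show ?thesis unfolding swept_def sweep_def by (auto simp: image_iff) (metis atLeastAtMost_iff)+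
qed

lemma compactin_swept: "compactin Y swept"
proof -
  have "compactin cyl ({0..T} \<times> Z)"
    unfolding cyl_def using compact_section
    by (simp add: compactin_Times compactin_subtopology)
  then have "compactin (subtopology Y swept) (sweep ` ({0..T} \<times> Z))"
    by (rule image_compactin[OF _ continuous_sweep])
  then show ?thesis
    by (simp add: sweep_fundamental_domain compactin_subtopology)
qed

text \<open>Restricted to the compact fundamental domain \<open>[0, T] \<times> Z\<close> the map \<open>sweep\<close> is a quotient map, so the
openness of an image can be tested on its preimage, which is a union of deck translates.\<close>

lemma open_map_sweep: "open_map cyl (subtopology Y swept) sweep"
  unfolding open_map_def
proof (intro allI impI)
  fix W assume W: "openin cyl W"
  then have WZ: "W \<subseteq> UNIV \<times> Z" using openin_subset by fastforce
  let ?\<sigma> = "\<lambda>k::int. \<lambda>(s, z). (s - k * T, \<phi> (k * T) z)"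
  let ?K = "subtopology cyl ({0..T} \<times> Z)"
  have "compactin cyl ({0..T} \<times> Z)"
    unfolding cyl_def using compact_section
    by (simp add: compactin_Times compactin_subtopology)
  then have "compact_space ?K" by (rule compact_space_subtopology)
  moreover have topK: "topspace ?K = {0..T} \<times> Z" by auto
  ultimately have quot: "quotient_map ?K (subtopology Y swept) sweep"
    using Hausdorff swept_subset continuous_sweep sweep_fundamental_domain
    by (intro continuous_imp_quotient_map)
       (auto intro: continuous_map_from_subtopology Hausdorff_space_subtopology)
  have "{p \<in> topspace cyl. sweep p \<in> sweep ` W} = (\<Union>k. {p \<in> topspace cyl. ?\<sigma> k p \<in> W})"
  proof -
    have "sweep (s, z) \<in> sweep ` W \<longleftrightarrow> (\<exists>k. ?\<sigma> k (s, z) \<in> W)" if "z \<in> Z" for s z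
    proof -
      have "sweep (s, z) \<in> sweep ` W \<longleftrightarrow> (\<exists>(s', z') \<in> W. \<phi> s z = \<phi> s' z')"
        unfolding sweep_def image_iff case_prod_unfold by simp
      also have "\<dots> \<longleftrightarrow> (\<exists>(s', z') \<in> W. \<exists>k::int. s' = s - k * T \<and> z' = \<phi> (k * T) z)"
        using sweep_eq_iff[OF that] WZ by fast
      also have "\<dots> \<longleftrightarrow> (\<exists>k. ?\<sigma> k (s, z) \<in> W)" by fastforce
      finally show ?thesis .
    qed
    then show ?thesis unfolding topspace_cyl by blast
  qed
  moreover have "openin cyl {p \<in> topspace cyl. ?\<sigma> k p \<in> W}" for k
    using openin_continuous_map_preimage[OF continuous_deck W] .
  ultimately have "openin cyl {p \<in> topspace cyl. sweep p \<in> sweep ` W}"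
    by (metis (no_types, lifting) imageE openin_Union)
  then have "openin ?K {p \<in> topspace ?K. sweep p \<in> sweep ` W}"
    unfolding openin_subtopology topK by (auto intro!: exI[of _ "{p \<in> topspace cyl. sweep p \<in> sweep ` W}"])
  moreover have "sweep ` W \<subseteq> topspace (subtopology Y swept)"
    using WZ swept_subset by (auto simp: swept_def)
  ultimately show "openin (subtopology Y swept) (sweep ` W)"
    using quot unfolding quotient_map_def by blast
qed

definition chart_dom :: "real \<Rightarrow> 'a set" where
  "chart_dom c = sweep ` ({c - T/4 <..< c + T/4} \<times> Z)"

text \<open>Two points of the cylinder over the same point differ in time by a multiple of \<open>T\<close>, and the strip is
shorter than \<open>T\<close>. Its length \<open>T/2\<close> is chosen for the changes of charts.\<close>

lemma homeomorphic_map_sweep: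
  "homeomorphic_map (prod_topology (top_of_set {c - T/4 <..< c + T/4}) (subtopology Y Z))
     (subtopology (subtopology Y swept) (chart_dom c)) sweep"
proof -
  let ?I = "{c - T/4 <..< c + T/4}"
  have top: "prod_topology (top_of_set ?I) (subtopology Y Z) = subtopology cyl (?I \<times> Z)"
    by (simp add: cyl_def prod_topology_subtopology subtopology_subtopology Times_Int_Times)
  have "inj_on sweep (?I \<times> Z)"
  proof (rule inj_onI, clarify)
    fix s z s' z'
    assume *: "s \<in> ?I" "s' \<in> ?I" "z \<in> Z" "z' \<in> Z" "sweep (s, z) = sweep (s', z')"
    then obtain k :: int where k: "s' = s - k * T" "z' = \<phi> (k * T) z"
      using sweep_eq_iff[of z z' s s'] by (auto simp: sweep_def)
    have "\<bar>k * T\<bar> < 1 * T" using * k(1) by auto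
    then have "k = 0" using period_pos by (simp add: abs_mult)
    then show "s = s' \<and> z = z'"
      using k * section_subset flow_zero by auto
  qed
  then have "embedding_map (subtopology cyl (?I \<times> Z)) (subtopology Y swept) sweep"
    using open_map_sweep continuous_sweep openin_strip
    by (intro injective_open_imp_embedding_map open_map_from_subtopology
        continuous_map_from_subtopology) (auto intro: inj_on_subset)
  moreover have "sweep ` topspace (subtopology cyl (?I \<times> Z)) = chart_dom c"
    by (auto simp: chart_dom_def)
  ultimately show ?thesis
    unfolding top embedding_map_def by simp
qed

lemma chart_dom_iff: "p \<in> chart_dom c \<longleftrightarrow> (\<exists>s\<in>{c - T/4 <..< c + T/4}. \<exists>z\<in>Z. p = \<phi> s z)"
  unfolding chart_dom_def sweep_def image_iff case_prod_unfold
  by (metis (no_types, lifting) SigmaE SigmaI fst_conv snd_conv)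

lemma openin_chart_dom: "openin (subtopology Y swept) (chart_dom c)"
  using open_map_sweep openin_strip unfolding open_map_def chart_dom_def by blast

text \<open>Charts are the inverses of \<open>sweep\<close> on the strips \<open>{c - T/4 <..< c + T/4} \<times> Z\<close>. Two points of \<open>\<real> \<times> Z\<close>
over the same point differ by a deck transformation, whose exponent \<open>k\<close> is constant on the overlap
of two strips. A change of charts is therefore \<open>(r, t) \<mapsto> (r - kT, b t)\<close>, a translation in the flow
direction.\<close>

lemma one_dim_solenoid_swept:
  assumes "subtopology Y Z homeomorphic_space cantor_space"
  shows "one_dim_solenoid (subtopology Y swept)"
proof -
  let ?N = "subtopology Y swept"
  let ?I = "\<lambda>c. {c - T/4 <..< c + T/4}"
  obtain \<theta> \<theta>' where \<theta>: "homeomorphic_maps (subtopology Y Z) cantor_space \<theta> \<theta>'"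
    using assms unfolding homeomorphic_space_def by blast
  have top_cantor: "topspace cantor_space = UNIV" by (simp add: cantor_space_def)
  have \<theta>': "\<theta>' t \<in> Z" "\<theta> (\<theta>' t) = t" for t
    using \<theta> unfolding homeomorphic_maps_def continuous_map_def by (auto simp: top_cantor)
  have \<theta>'\<theta>: "\<theta>' (\<theta> z) = z" if "z \<in> Z" for z
    using \<theta> that unfolding homeomorphic_maps_def by simp
  obtain g where g: "homeomorphic_maps (prod_topology (top_of_set (?I c)) (subtopology Y Z))
     (subtopology ?N (chart_dom c)) sweep (g c)" for c
    using homeomorphic_map_sweep unfolding homeomorphic_map_maps by metis
  define chart where "chart c = (\<lambda>(s, z). (s, \<theta> z)) \<circ> g c" for c
  have chart_eq: "chart c (\<phi> s z) = (s, \<theta> z)" if "s \<in> ?I c" "z \<in> Z" for c s z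
    using g[of c] that unfolding homeomorphic_maps_def chart_def by (auto simp: sweep_def)
  have chart: "solenoid_chart ?N (chart_dom c) (chart c)" for c
  proof -
    have "homeomorphic_map (subtopology ?N (chart_dom c))
        (prod_topology (top_of_set (?I c)) (subtopology Y Z)) (g c)"
      using g homeomorphic_maps_map by blast
    moreover have "homeomorphic_map (prod_topology (top_of_set (?I c)) (subtopology Y Z))
        (prod_topology (top_of_set (?I c)) cantor_space) (\<lambda>(s, z). (s, \<theta> z))"
    proof -
      have "homeomorphic_maps (top_of_set (?I c)) (top_of_set (?I c)) (\<lambda>s. s) (\<lambda>s. s)"
        by (simp add: homeomorphic_maps_def)
      then show ?thesis
        using \<theta> homeomorphic_maps_prod[of "top_of_set (?I c)" "subtopology Y Z" "top_of_set (?I c)"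
            cantor_space "\<lambda>s. s" \<theta> "\<lambda>s. s" \<theta>']
        unfolding homeomorphic_map_maps by blast
    qed
    ultimately have "homeomorphic_map (subtopology ?N (chart_dom c))
        (prod_topology (top_of_set (?I c)) cantor_space) (chart c)"
      unfolding chart_def by (rule homeomorphic_map_compose)
    then show ?thesis
      using openin_chart_dom period_pos unfolding solenoid_chart_def
      by (intro conjI exI[of _ "?I c"]) auto
  qed
  have trans: "solenoid_transition (chart_dom c \<inter> chart_dom d) (chart c) (chart d)" for c d
  proof (cases "chart_dom c \<inter> chart_dom d = {}")
    case True
    then show ?thesis
      unfolding solenoid_transition_def
      by (intro exI[of _ "\<lambda>r t. r - 0"] exI[of _ "\<lambda>t. t"] conjI allI
          smooth_on_open_translation) simp_all
  next
    case False
    then obtain p where p: "p \<in> chart_dom c" "p \<in> chart_dom d" by blast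
    obtain s z where s: "s \<in> ?I c" "z \<in> Z" "p = \<phi> s z"
      using p(1) unfolding chart_dom_iff by blast
    obtain s' z' where s': "s' \<in> ?I d" "z' \<in> Z" "p = \<phi> s' z'"
      using p(2) unfolding chart_dom_iff by blast
    have 0: "s \<in> ?I c" "z \<in> Z" "s' \<in> ?I d" "z' \<in> Z" "\<phi> s z = \<phi> s' z'"
      using s s' by simp_all
    then obtain k :: int where k: "s' = s - k * T"
      using sweep_eq_iff[OF 0(2,4), of s s'] by blast
    \<comment> \<open>Both charts have length \<open>T/2\<close>, so all points of the overlap use the same \<open>k\<close>.\<close>
    have same_k: "z'' = \<phi> (k * T) w \<and> s'' = r - k * T"
      if rw: "r \<in> ?I c" "w \<in> Z" "s'' \<in> ?I d" "z'' \<in> Z" "\<phi> r w = \<phi> s'' z''" for r w s'' z''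
    proof -
      obtain l :: int where l: "s'' = r - l * T" "z'' = \<phi> (l * T) w"
        using sweep_eq_iff[OF rw(2,4), of r s''] rw(5) by blast
      have "\<bar>l * T - k * T\<bar> < 1 * T"
        using rw(1,3) 0(1,3) k l(1) unfolding greaterThanLessThan_iff by linarith
      then have "\<bar>real_of_int (l - k)\<bar> * T < 1 * T"
        using period_pos by (simp add: abs_mult flip: left_diff_distrib)
      then have "l = k" using period_pos by simp
      then show ?thesis using l by simp
    qed
    let ?W = "chart_dom c \<inter> chart_dom d"
    have "\<forall>p\<in>?W. \<forall>r t. chart c p = (r, t) \<longrightarrow> chart d p = (r - k * T, \<theta> (\<phi> (k * T) (\<theta>' t)))"
    proof (intro ballI allI impI)
      fix p r t assume p: "p \<in> ?W" "chart c p = (r, t)"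
      obtain r' w where r': "r' \<in> ?I c" "w \<in> Z" "p = \<phi> r' w"
        using p(1) unfolding Int_iff chart_dom_iff[of p c] by blast
      obtain s'' z'' where s'': "s'' \<in> ?I d" "z'' \<in> Z" "p = \<phi> s'' z''"
        using p(1) unfolding Int_iff chart_dom_iff[of p d] by blast
      have w: "r' \<in> ?I c" "w \<in> Z" "s'' \<in> ?I d" "z'' \<in> Z" "p = \<phi> r' w" "\<phi> r' w = \<phi> s'' z''"
        using r' s'' by simp_all
      have "(r', \<theta> w) = (r, t)" using p(2) chart_eq[OF w(1,2)] w(5) by simp
      moreover have "chart d p = (s'', \<theta> z'')" using chart_eq[OF w(3,4)] w(5,6) by simp
      ultimately show "chart d p = (r - k * T, \<theta> (\<phi> (k * T) (\<theta>' t)))"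
        using same_k w \<theta>'\<theta> by auto
    qed
    moreover have "{r. (r, t) \<in> chart c ` ?W} = ?I c \<inter> {r. r - k * T \<in> ?I d}" for t
    proof (rule Set.set_eqI, rule iffI)
      fix r assume "r \<in> {r. (r, t) \<in> chart c ` ?W}"
      then obtain p where p: "p \<in> ?W" "chart c p = (r, t)" unfolding mem_Collect_eq image_iff by metis
      obtain r' w where r': "r' \<in> ?I c" "w \<in> Z" "p = \<phi> r' w"
        using p(1) unfolding Int_iff chart_dom_iff[of p c] by blast
      obtain s'' z'' where s'': "s'' \<in> ?I d" "z'' \<in> Z" "p = \<phi> s'' z''"
        using p(1) unfolding Int_iff chart_dom_iff[of p d] by blast
      have w: "r' \<in> ?I c" "w \<in> Z" "s'' \<in> ?I d" "z'' \<in> Z" "p = \<phi> r' w" "\<phi> r' w = \<phi> s'' z''"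
        using r' s'' by simp_all
      have "(r', \<theta> w) = (r, t)" using p(2) chart_eq[OF w(1,2)] w(5) by simp
      then show "r \<in> ?I c \<inter> {r. r - k * T \<in> ?I d}" using same_k[OF w(1-4,6)] w(1,3) by simp
    next
      fix r assume r: "r \<in> ?I c \<inter> {r. r - k * T \<in> ?I d}"
      have "\<phi> r (\<theta>' t) = \<phi> (r - k * T) (\<phi> (k * T) (\<theta>' t))"
        using sweep_eq_iff[OF \<theta>'(1) deck_in_section[OF \<theta>'(1)]] by blast
      then have "\<phi> r (\<theta>' t) \<in> ?W"
        using r \<theta>'(1)[of t] deck_in_section[OF \<theta>'(1), of k t] unfolding Int_iff chart_dom_iff
        by blast
      moreover have "chart c (\<phi> r (\<theta>' t)) = (r, t)" using chart_eq r \<theta>' by auto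
      ultimately show "r \<in> {r. (r, t) \<in> chart c ` ?W}" unfolding mem_Collect_eq image_iff by metis
    qed
    moreover have "open (?I c \<inter> {r. r - k * T \<in> ?I d})"
    proof -
      have "{r. r - k * T \<in> ?I d} = {d - T/4 + k * T <..< d + T/4 + k * T}" by auto
      then show ?thesis by auto
    qed
    ultimately show ?thesis
      unfolding solenoid_transition_def
      by (intro exI[of _ "\<lambda>r t. r - k * T"] exI[of _ "\<lambda>t. \<theta> (\<phi> (k * T) (\<theta>' t))"])
        (simp add: smooth_on_open_translation)
  qed
  have "topspace ?N = (\<Union>c. chart_dom c)"
  proof (rule Set.set_eqI, rule iffI)
    fix p assume "p \<in> topspace ?N"
    then obtain s z where "z \<in> Z" "p = sweep (s, z)" by (auto simp: swept_def)
    then have "p \<in> chart_dom s" using period_pos by (auto simp: chart_dom_def)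
    then show "p \<in> (\<Union>c. chart_dom c)" by blast
  qed (use swept_subset in \<open>auto simp: chart_dom_def swept_def\<close>)
  moreover have "second_countable ?N"
  proof -
    have "second_countable (prod_topology euclideanreal cantor_space)"
      by (intro second_countable_prod_topology second_countable_euclidean second_countable_cantor_space)
    moreover have "cyl homeomorphic_space prod_topology euclideanreal cantor_space"
      unfolding cyl_def
      using assms by (intro homeomorphic_space_prod_topology homeomorphic_space_refl)
    ultimately have "second_countable cyl"
      by (simp add: homeomorphic_space_second_countability)
    moreover have "sweep ` topspace cyl = topspace ?N" using swept_subset by (auto simp: swept_def)
    ultimately show ?thesis
      by (intro second_countable_open_map_image[OF continuous_sweep open_map_sweep])
  qed
  moreover have "compact_space ?N" using compactin_swept by (rule compact_space_subtopology)
  then have "locally_compact_space ?N" by (rule compact_imp_locally_compact_space) 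
  moreover have "Hausdorff_space ?N" using Hausdorff by (rule Hausdorff_space_subtopology)
  ultimately show ?thesis
    unfolding one_dim_solenoid_def
    by (intro conjI exI[of _ "range (\<lambda>c. (chart_dom c, chart c))"]) (use chart trans in auto)
qed

end

section \<open>Open quotients and discrete subgroups\<close>

lemma openin_prod_box:
  assumes "openin (prod_topology X Y) W" "(x, y) \<in> W"
  obtains U V where "openin X U" "openin Y V" "x \<in> U" "y \<in> V" "U \<times> V \<subseteq> W"
  using assms(1)[unfolded openin_prod_topology_alt, rule_format, OF assms(2)] by blast

lemma open_map_prod:
  assumes "open_map X X' f" "open_map Y Y' g"
  shows "open_map (prod_topology X Y) (prod_topology X' Y') (\<lambda>(x, y). (f x, g y))"
  unfolding open_map_def
proof (intro allI impI)
  fix W assume W: "openin (prod_topology X Y) W"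
  show "openin (prod_topology X' Y') ((\<lambda>(x, y). (f x, g y)) ` W)"
    unfolding openin_prod_topology_alt
  proof (intro allI impI)
    fix a b assume "(a, b) \<in> (\<lambda>(x, y). (f x, g y)) ` W"
    then obtain x y where xy: "(x, y) \<in> W" "a = f x" "b = g y" by auto
    then obtain U V where UV: "openin X U" "openin Y V" "x \<in> U" "y \<in> V" "U \<times> V \<subseteq> W"
      using openin_prod_box[OF W] by blast
    have "f ` U \<times> g ` V \<subseteq> (\<lambda>(x, y). (f x, g y)) ` W"
      using UV(5) by fastforce
    moreover have "openin X' (f ` U)" "openin Y' (g ` V)"
      using assms UV unfolding open_map_def by blast+
    ultimately show "\<exists>U V. openin X' U \<and> openin Y' V \<and> a \<in> U \<and> b \<in> V \<and>
        U \<times> V \<subseteq> (\<lambda>(x, y). (f x, g y)) ` W"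
      using UV(3,4) xy(2,3) by blast
  qed
qed

lemma quotient_map_prod_open:
  assumes "quotient_map X X' f" "open_map X X' f" "quotient_map Y Y' g" "open_map Y Y' g"
  shows "quotient_map (prod_topology X Y) (prod_topology X' Y') (\<lambda>(x, y). (f x, g y))"
proof (rule continuous_open_imp_quotient_map)
  show "continuous_map (prod_topology X Y) (prod_topology X' Y') (\<lambda>(x, y). (f x, g y))"
    using assms by (simp add: continuous_map_prod_top quotient_imp_continuous_map)
  show "open_map (prod_topology X Y) (prod_topology X' Y') (\<lambda>(x, y). (f x, g y))"
    using assms by (intro open_map_prod)
  show "(\<lambda>(x, y). (f x, g y)) ` topspace (prod_topology X Y) = topspace (prod_topology X' Y')"
    using assms by (simp add: image_paired_Times quotient_imp_surjective_map)
qed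

text \<open>Two points with different images have a product neighbourhood \<open>U \<times> V\<close> off the closed relation, and
the open images of \<open>U\<close> and \<open>V\<close> are then disjoint.\<close>

lemma Hausdorff_space_open_quotient:
  assumes quot: "quotient_map X Y f" and "open": "open_map X Y f"
    and closed: "closedin (prod_topology X X) {(a, b). a \<in> topspace X \<and> b \<in> topspace X \<and> f a = f b}"
  shows "Hausdorff_space Y"
  unfolding Hausdorff_space_def
proof (intro allI impI)
  fix p q assume pq: "p \<in> topspace Y \<and> q \<in> topspace Y \<and> p \<noteq> q"
  have surj: "f ` topspace X = topspace Y" using quot by (rule quotient_imp_surjective_map)
  obtain a b where ab: "a \<in> topspace X" "b \<in> topspace X" "p = f a" "q = f b"
    using pq surj by blast
  let ?R = "{(a, b). a \<in> topspace X \<and> b \<in> topspace X \<and> f a = f b}"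
  have "openin (prod_topology X X) (topspace (prod_topology X X) - ?R)"
    using closed by blast
  from openin_prod_box[OF this, of a b] obtain U V where UV: "openin X U" "openin X V" "a \<in> U" "b \<in> V"
      "U \<times> V \<subseteq> topspace (prod_topology X X) - ?R"
    using ab pq by auto
  have "disjnt (f ` U) (f ` V)"
    using UV(5) openin_subset[OF UV(1)] openin_subset[OF UV(2)] unfolding disjnt_def by fast
  then show "\<exists>U V. openin Y U \<and> openin Y V \<and> p \<in> U \<and> q \<in> V \<and> disjnt U V"
    using UV ab "open" unfolding open_map_def by blast
qed

locale topological_group = group G for G (structure) +
  fixes \<tau> :: "'a topology"
  assumes topspace_group [simp]: "topspace \<tau> = carrier G"
    and Hausdorff_group: "Hausdorff_space \<tau>"
    and continuous_mult: "continuous_map (prod_topology \<tau> \<tau>) \<tau> (\<lambda>(a, b). a \<otimes> b)"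
    and continuous_inv: "continuous_map \<tau> \<tau> (\<lambda>a. inv a)"
begin

lemma continuous_mult':
  "continuous_map X \<tau> f \<Longrightarrow> continuous_map X \<tau> g \<Longrightarrow> continuous_map X \<tau> (\<lambda>x. f x \<otimes> g x)"
  using continuous_map_compose[OF continuous_map_pairedI continuous_mult, of X f g]
  by (simp add: o_def)

lemma continuous_inv': "continuous_map X \<tau> f \<Longrightarrow> continuous_map X \<tau> (\<lambda>x. inv (f x))"
  using continuous_map_compose[OF _ continuous_inv, of X f] by (simp add: o_def)

text \<open>If \<open>V\<close> is a neighbourhood of the identity meeting \<open>H\<close> in the identity alone and \<open>g\<close> is a limit of \<open>H\<close>,
then a neighbourhood \<open>U\<close> of \<open>g\<close> with \<open>U U\<inverse> \<subseteq> V\<close> contains only one element of \<open>H\<close>, which must be \<open>g\<close>.\<close>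

lemma closedin_discrete_subgroup:
  assumes H: "subgroup H G" and disc: "subtopology \<tau> H = discrete_topology H"
  shows "closedin \<tau> H"
proof -
  note HG = subgroup.subset[OF H]
  have "openin (subtopology \<tau> H) {\<one>}"
    unfolding disc using subgroup.one_closed[OF H] by simp
  then obtain V where V: "openin \<tau> V" "V \<inter> H = {\<one>}"
    unfolding openin_subtopology by blast
  have "\<tau> closure_of H \<subseteq> H"
  proof
    fix g assume g: "g \<in> \<tau> closure_of H"
    then have gG: "g \<in> carrier G" by (simp add: in_closure_of)
    have hit: "\<exists>y\<in>H. y \<in> W" if "openin \<tau> W" "g \<in> W" for W
      using g that unfolding in_closure_of by auto
    let ?D = "{p \<in> topspace (prod_topology \<tau> \<tau>). fst p \<otimes> inv (snd p) \<in> V}"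
    have "continuous_map (prod_topology \<tau> \<tau>) \<tau> (\<lambda>p. fst p \<otimes> inv (snd p))"
      by (intro continuous_mult' continuous_inv' continuous_map_fst continuous_map_snd)
    then have "openin (prod_topology \<tau> \<tau>) ?D"
      using V(1) by (rule openin_continuous_map_preimage)
    from openin_prod_box[OF this, of g g] obtain U W where UW: "openin \<tau> U" "openin \<tau> W" "g \<in> U" "g \<in> W" "U \<times> W \<subseteq> ?D"
      using gG V(2) by auto
    have unique: "a = b" if "a \<in> U \<inter> W \<inter> H" "b \<in> U \<inter> W \<inter> H" for a b
    proof -
      have "a \<otimes> inv b \<in> V \<inter> H"
        using that UW(5) H by (auto intro: subgroup.m_closed subgroup.m_inv_closed)
      then have "a \<otimes> inv b = \<one>" using V(2) by blast
      then show ?thesis using that HG by (metis IntD2 inv_equality inv_inv subsetD inv_closed)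
    qed
    have UWo: "openin \<tau> (U \<inter> W)" "g \<in> U \<inter> W" using UW by auto
    then obtain a where a: "a \<in> H" "a \<in> U \<inter> W"
      using hit[OF UWo] by blast
    show "g \<in> H"
    proof (rule ccontr)
      assume "g \<notin> H"
      have "closedin \<tau> {a}"
        using Hausdorff_group a HG by (simp add: closedin_Hausdorff_sing_eq subsetD)
      then have "openin \<tau> (U \<inter> W - {a})" using UWo(1) by (rule openin_diff[rotated])
      from hit[OF this] obtain b where "b \<in> H" "b \<in> U \<inter> W - {a}"
        using UWo(2) a(1) \<open>g \<notin> H\<close> by blast
      then show False using unique[of a b] a by blast
    qed
  qed
  then show ?thesis
    using HG by (metis closure_of_subset closure_of_eq subset_antisym topspace_group)
qed

lemma rcoset_eq_iff:
  assumes H: "subgroup H G" and ab: "a \<in> carrier G" "b \<in> carrier G"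
  shows "H #> a = H #> b \<longleftrightarrow> a \<otimes> inv b \<in> H"
proof
  assume eq: "H #> a = H #> b"
  then obtain h where "h \<in> H" "a = h \<otimes> b"
    using rcos_self[OF ab(1) H] unfolding r_coset_def by blast
  then show "a \<otimes> inv b \<in> H" using ab(2) H by (simp add: m_assoc subgroup.mem_carrier)
next
  assume "a \<otimes> inv b \<in> H"
  then have "H #> (a \<otimes> inv b) = H" using coset_join2 H ab by auto
  then show "H #> a = H #> b" using ab subgroup.subset[OF H] by (rule coset_mult_inv1)
qed

lemma quotient_map_rcosets:
  "quotient_map \<tau> (quotient_topology \<tau> (\<lambda>u. H #> u)) (\<lambda>u. H #> u)"
  by (rule quotient_map_quotient_topology)

lemma open_map_rcosets:
  assumes H: "subgroup H G"
  shows "open_map \<tau> (quotient_topology \<tau> (\<lambda>u. H #> u)) (\<lambda>u. H #> u)"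
  unfolding open_map_def
proof (intro allI impI)
  fix U assume U: "openin \<tau> U"
  then have UG: "U \<subseteq> carrier G" using openin_subset by fastforce
  have "{x \<in> topspace \<tau>. H #> x \<in> (\<lambda>u. H #> u) ` U} = (\<Union>h\<in>H. {x \<in> topspace \<tau>. h \<otimes> x \<in> U})"
  proof (rule Set.set_eqI, rule iffI)
    fix x assume x: "x \<in> {x \<in> topspace \<tau>. H #> x \<in> (\<lambda>u. H #> u) ` U}"
    then obtain u where u: "u \<in> U" "H #> u = H #> x" by auto
    then have "u \<in> H #> x" using rcos_self[OF _ H, of u] UG by auto
    then obtain h where "h \<in> H" "u = h \<otimes> x" unfolding r_coset_def by blast
    then show "x \<in> (\<Union>h\<in>H. {x \<in> topspace \<tau>. h \<otimes> x \<in> U})" using x u by blast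
  next
    fix x assume "x \<in> (\<Union>h\<in>H. {x \<in> topspace \<tau>. h \<otimes> x \<in> U})"
    then obtain h where h: "h \<in> H" "x \<in> carrier G" "h \<otimes> x \<in> U" by auto
    then have "h \<otimes> x \<in> H #> x" unfolding r_coset_def by blast
    then have "H #> x = H #> (h \<otimes> x)" using repr_independence h(2) H by blast
    then show "x \<in> {x \<in> topspace \<tau>. H #> x \<in> (\<lambda>u. H #> u) ` U}" using h by auto
  qed
  moreover have "openin \<tau> {x \<in> topspace \<tau>. h \<otimes> x \<in> U}" if "h \<in> H" for h
  proof (rule openin_continuous_map_preimage[OF _ U])
    show "continuous_map \<tau> \<tau> (\<lambda>x. h \<otimes> x)"
      using subgroup.mem_carrier[OF H that]
      by (intro continuous_mult') auto
  qed
  ultimately have "openin \<tau> {x \<in> topspace \<tau>. H #> x \<in> (\<lambda>u. H #> u) ` U}"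
    by (metis (no_types, lifting) imageE openin_Union)
  then show "openin (quotient_topology \<tau> (\<lambda>u. H #> u)) ((\<lambda>u. H #> u) ` U)"
    unfolding openin_quotient_topology using UG by (auto simp del: image_iff)
qed

text \<open>The cosets of \<open>a\<close> and \<open>b\<close> agree iff \<open>a b\<inverse> \<in> H\<close>, a closed condition because a discrete subgroup is
closed.\<close>

lemma Hausdorff_space_rcosets:
  assumes H: "subgroup H G" and disc: "subtopology \<tau> H = discrete_topology H"
  shows "Hausdorff_space (quotient_topology \<tau> (\<lambda>u. H #> u))"
proof (rule Hausdorff_space_open_quotient[OF quotient_map_rcosets open_map_rcosets[OF H]])
  have "continuous_map (prod_topology \<tau> \<tau>) \<tau> (\<lambda>p. fst p \<otimes> inv (snd p))"
    by (intro continuous_mult' continuous_inv' continuous_map_fst continuous_map_snd)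
  then have "closedin (prod_topology \<tau> \<tau>)
      {p \<in> topspace (prod_topology \<tau> \<tau>). fst p \<otimes> inv (snd p) \<in> H}"
    using closedin_discrete_subgroup[OF assms] by (rule closedin_continuous_map_preimage)
  moreover have "{p \<in> topspace (prod_topology \<tau> \<tau>). fst p \<otimes> inv (snd p) \<in> H} =
      {(a, b). a \<in> topspace \<tau> \<and> b \<in> topspace \<tau> \<and> H #> a = H #> b}"
    by (rule Set.set_eqI) (simp add: rcoset_eq_iff[OF H] case_prod_unfold mem_Times_iff cong: conj_cong)
  ultimately show "closedin (prod_topology \<tau> \<tau>)
      {(a, b). a \<in> topspace \<tau> \<and> b \<in> topspace \<tau> \<and> H #> a = H #> b}" by simp
qed

end

section \<open>The topological group PSL(2,R) and the horocycle flow\<close>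

lemma carrier_SL2R: "carrier SL2R = {A. det A = 1}"
  by (simp add: SL2R_def)

lemma quotient_map_psl_class: "quotient_map (top_of_set {A. det A = 1}) PSL2R_top psl_class"
  unfolding PSL2R_top_def carrier_SL2R by (rule quotient_map_quotient_topology)

lemma det_uminus_2: "det (- A :: real^2^2) = det A"
  by (simp add: det_2)

lemma psl_class_uminus: "psl_class (- A) = psl_class A"
  by (auto simp: psl_class_eq)

lemma psl_class_eq_iff: "psl_class A = psl_class B \<longleftrightarrow> A = B \<or> A = - B"
  unfolding psl_class_eq by (metis doubleton_eq_iff minus_minus)

text \<open>The saturation of an open set \<open>U\<close> is \<open>U \<union> - U\<close>. Openness is what makes the square of \<open>psl_class\<close> a
quotient map, so that multiplication descends continuously.\<close>

lemma open_map_psl_class: "open_map (top_of_set {A. det A = 1}) PSL2R_top psl_class"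
  unfolding open_map_def
proof (intro allI impI)
  let ?S = "{A :: real^2^2. det A = 1}"
  fix U assume U: "openin (top_of_set ?S) U"
  then have US: "U \<subseteq> ?S" using openin_subset by fastforce
  have "continuous_map (top_of_set ?S) (top_of_set ?S) uminus"
    by (auto simp: det_uminus_2 intro!: continuous_intros)
  then have "openin (top_of_set ?S) {A \<in> topspace (top_of_set ?S). - A \<in> U}"
    using U by (rule openin_continuous_map_preimage)
  then have "openin (top_of_set ?S) (U \<union> {A \<in> topspace (top_of_set ?S). - A \<in> U})"
    using U by blast
  moreover have "{A \<in> ?S. psl_class A \<in> psl_class ` U} = U \<union> {A \<in> ?S. - A \<in> U}"
    using US by (auto simp: psl_class_eq_iff) (metis minus_minus psl_class_uminus image_eqI)
  ultimately show "openin PSL2R_top (psl_class ` U)"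
    using US unfolding PSL2R_top_def carrier_SL2R openin_quotient_topology by auto
qed

lemma continuous_on_matrix_mult [continuous_intros]:
  fixes f g :: "'a::topological_space \<Rightarrow> real^2^2"
  assumes "continuous_on S f" "continuous_on S g"
  shows "continuous_on S (\<lambda>x. f x ** g x)"
  unfolding matrix_matrix_mult_def by (intro continuous_intros assms)

definition adjugate :: "real^2^2 \<Rightarrow> real^2^2" where
  "adjugate A = vector [vector [A$2$2, - A$1$2], vector [- A$2$1, A$1$1]]"

lemma det_adjugate: "det (adjugate A) = det A"
  by (simp add: adjugate_def det_2 mult.commute)

lemma adjugate_mult: "det A = 1 \<Longrightarrow> adjugate A ** A = mat 1"
  by (simp add: adjugate_def vec_eq_iff matrix_matrix_mult_def mat_def UNIV_2 forall_2 det_2 algebra_simps)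

lemma continuous_on_adjugate: "continuous_on S adjugate"
proof -
  have eq: "adjugate = (\<lambda>A. \<chi> i j. if i = 1 then if j = 1 then A$2$2 else - A$1$2
      else if j = 1 then - A$2$1 else A$1$1)"
    by (simp add: fun_eq_iff adjugate_def vec_eq_iff forall_2)
  show ?thesis
    unfolding eq
  proof (intro continuous_on_vec_lambda)
    fix i j :: 2
    show "continuous_on S (\<lambda>A::real^2^2. if i = 1 then if j = 1 then A$2$2 else - A$1$2
        else if j = 1 then - A$2$1 else A$1$1)"
      by (cases "i = 1"; cases "j = 1") (auto intro!: continuous_intros)
  qed
qed

lemma one_PSL2R: "\<one>\<^bsub>PSL2R\<^esub> = psl_class (mat 1)"
  by (auto simp: PSL2R_def FactGroup_def psl_class_eq)

lemma inv_PSL2R: "det A = 1 \<Longrightarrow> inv\<^bsub>PSL2R\<^esub> (psl_class A) = psl_class (adjugate A)"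
  by (rule group.inv_equality[OF group_PSL2R])
    (auto simp: mult_PSL2R det_adjugate adjugate_mult one_PSL2R carrier_PSL2R)

interpretation PSL: topological_group PSL2R PSL2R_top
proof (intro topological_group.intro group_PSL2R topological_group_axioms.intro)
  let ?S = "{A :: real^2^2. det A = 1}"
  show "topspace PSL2R_top = carrier PSL2R" by (rule topspace_PSL2R_top)
  note q = quotient_map_psl_class and o = open_map_psl_class
  have sq: "prod_topology (top_of_set ?S) (top_of_set ?S) = top_of_set (?S \<times> ?S)" by simp
  have c: "continuous_map X PSL2R_top (\<lambda>x. psl_class (f x))"
    if "continuous_map X (top_of_set ?S) f" for X :: "'z topology" and f
    using continuous_map_compose[OF that quotient_imp_continuous_map[OF q]] by (simp add: o_def)
  show "Hausdorff_space PSL2R_top"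
  proof (rule Hausdorff_space_open_quotient[OF q o])
    have "{(a, b). a \<in> topspace (top_of_set ?S) \<and> b \<in> topspace (top_of_set ?S) \<and>
        psl_class a = psl_class b} = (?S \<times> ?S) \<inter> ({p. fst p = snd p} \<union> {p. fst p = - snd p})"
      by (auto simp: psl_class_eq_iff)
    moreover have "closed ({p. fst p = snd p} \<union> {p::(real^2^2) \<times> (real^2^2). fst p = - snd p})"
      by (intro closed_Un closed_Collect_eq continuous_intros)
    ultimately show "closedin (prod_topology (top_of_set ?S) (top_of_set ?S))
        {(a, b). a \<in> topspace (top_of_set ?S) \<and> b \<in> topspace (top_of_set ?S) \<and>
          psl_class a = psl_class b}"
      unfolding sq by (metis (no_types, lifting) closedin_closed)
  qed
  show "continuous_map (prod_topology PSL2R_top PSL2R_top) PSL2R_top (\<lambda>(a, b). a \<otimes>\<^bsub>PSL2R\<^esub> b)"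
  proof (rule continuous_compose_quotient_map[OF quotient_map_prod_open[OF q o q o]])
    have "continuous_map (top_of_set (?S \<times> ?S)) (top_of_set ?S) (\<lambda>p. fst p ** snd p)"
      by (auto simp: det_mul intro!: continuous_intros)
    then have "continuous_map (top_of_set (?S \<times> ?S)) PSL2R_top (\<lambda>p. psl_class (fst p ** snd p))"
      by (rule c)
    then show "continuous_map (prod_topology (top_of_set ?S) (top_of_set ?S)) PSL2R_top
        ((\<lambda>(a, b). a \<otimes>\<^bsub>PSL2R\<^esub> b) \<circ> (\<lambda>(x, y). (psl_class x, psl_class y)))"
      unfolding sq by (rule continuous_map_eq) (auto simp: mult_PSL2R)
  qed
  show "continuous_map PSL2R_top PSL2R_top (\<lambda>a. inv\<^bsub>PSL2R\<^esub> a)"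
  proof (rule continuous_compose_quotient_map[OF q])
    have "continuous_map (top_of_set ?S) (top_of_set ?S) adjugate"
      by (auto simp: det_adjugate continuous_on_adjugate)
    then have "continuous_map (top_of_set ?S) PSL2R_top (\<lambda>A. psl_class (adjugate A))"
      by (rule c)
    then show "continuous_map (top_of_set ?S) PSL2R_top ((\<lambda>a. inv\<^bsub>PSL2R\<^esub> a) \<circ> psl_class)"
      by (rule continuous_map_eq) (auto simp: inv_PSL2R)
  qed
qed

lemma continuous_horo_elt: "continuous_map euclideanreal PSL2R_top horo_elt"
proof -
  have eq: "(\<lambda>s. vector [vector [1, s], vector [0, 1]] :: real^2^2) =
      (\<lambda>s. \<chi> i j. if i = 1 \<and> j = 2 then s else if i = j then 1 else 0)"
    by (auto simp: fun_eq_iff vec_eq_iff forall_2)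
  have "continuous_on UNIV (\<lambda>s. vector [vector [1, s], vector [0, 1]] :: real^2^2)"
    unfolding eq
  proof (intro continuous_on_vec_lambda)
    fix i j :: 2
    show "continuous_on UNIV (\<lambda>s::real. if i = 1 \<and> j = 2 then s else if i = j then 1 else 0)"
      by (cases "i = 1 \<and> j = 2") auto
  qed
  then have "continuous_map euclideanreal (top_of_set {A. det A = 1})
      (\<lambda>s. vector [vector [1, s], vector [0, 1]] :: real^2^2)"
    unfolding continuous_map_in_subtopology by (simp add: det_2 image_subset_iff)
  from continuous_map_compose[OF this quotient_imp_continuous_map[OF quotient_map_psl_class]]
  show ?thesis by (simp add: o_def horo_elt_def[abs_def])
qed

lemma horo_elt_add: "horo_elt (s + t) = horo_elt s \<otimes>\<^bsub>PSL2R\<^esub> horo_elt t"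
proof -
  have "(vector [vector [1, s + t], vector [0, 1]] :: real^2^2) =
      vector [vector [1, s], vector [0, 1]] ** (vector [vector [1, t], vector [0, 1]] :: real^2^2)"
    by (simp add: vec_eq_iff matrix_matrix_mult_def UNIV_2 forall_2)
  then show ?thesis by (simp add: horo_elt_def mult_PSL2R det_2)
qed

lemma horo_elt_0: "horo_elt 0 = \<one>\<^bsub>PSL2R\<^esub>"
proof -
  have "vector [vector [1, 0], vector [0, 1]] = (mat 1 :: real^2^2)"
    by (simp add: vec_eq_iff mat_def forall_2)
  then show ?thesis by (simp add: horo_elt_def one_PSL2R)
qed

lemma horo_elt_eq_one: "horo_elt s = \<one>\<^bsub>PSL2R\<^esub> \<longleftrightarrow> s = 0"
  by (auto simp: horo_elt_def one_PSL2R psl_class_eq_iff vec_eq_iff forall_2 mat_def)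

lemma inv_horo_elt: "inv\<^bsub>PSL2R\<^esub> (horo_elt s) = horo_elt (- s)"
  using horo_elt_add[of "- s" s] horo_elt_0
  by (intro PSL.inv_equality) (auto simp: horo_elt_in_carrier)

text \<open>The unipotent group conjugated by \<open>v\<close> is a one-parameter group; stated for differences, this is the
form needed to recognise subgroups of its parameter line.\<close>

lemma conj_horo_diff:
  assumes v: "v \<in> carrier PSL2R"
  shows "v \<otimes>\<^bsub>PSL2R\<^esub> horo_elt (s - t) \<otimes>\<^bsub>PSL2R\<^esub> inv\<^bsub>PSL2R\<^esub> v =
     (v \<otimes>\<^bsub>PSL2R\<^esub> horo_elt s \<otimes>\<^bsub>PSL2R\<^esub> inv\<^bsub>PSL2R\<^esub> v) \<otimes>\<^bsub>PSL2R\<^esub>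
       inv\<^bsub>PSL2R\<^esub> (v \<otimes>\<^bsub>PSL2R\<^esub> horo_elt t \<otimes>\<^bsub>PSL2R\<^esub> inv\<^bsub>PSL2R\<^esub> v)"
proof -
  have "horo_elt (s - t) = horo_elt s \<otimes>\<^bsub>PSL2R\<^esub> inv\<^bsub>PSL2R\<^esub> horo_elt t"
    using horo_elt_add[of s "- t"] by (simp add: inv_horo_elt)
  then show ?thesis
    using v horo_elt_in_carrier
    by (simp add: PSL.inv_mult_group PSL.m_assoc PSL.inv_solve_left)
qed

lemma continuous_horocycle_flow:
  assumes \<Gamma>: "subgroup \<Gamma> PSL2R"
  shows "continuous_map (prod_topology euclideanreal (T1 \<Gamma>)) (T1 \<Gamma>) (\<lambda>(s, x). horocycle_flow s x)"
proof -
  let ?p = "\<lambda>u. \<Gamma> #>\<^bsub>PSL2R\<^esub> u"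
  have q: "quotient_map PSL2R_top (T1 \<Gamma>) ?p" "open_map PSL2R_top (T1 \<Gamma>) ?p"
    unfolding T1_def using PSL.quotient_map_rcosets PSL.open_map_rcosets[OF \<Gamma>] by auto
  have i: "quotient_map euclideanreal euclideanreal (\<lambda>s. s)" "open_map euclideanreal euclideanreal (\<lambda>s. s)"
    by (auto simp: open_map_def quotient_map_def)
  have "continuous_map (prod_topology euclideanreal PSL2R_top) PSL2R_top (\<lambda>p. snd p \<otimes>\<^bsub>PSL2R\<^esub> horo_elt (fst p))"
    by (intro PSL.continuous_mult' continuous_map_snd
        continuous_map_compose[OF continuous_map_fst continuous_horo_elt, unfolded o_def])
  from continuous_map_compose[OF this quotient_imp_continuous_map[OF q(1)]]
  have "continuous_map (prod_topology euclideanreal PSL2R_top) (T1 \<Gamma>)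
      ((\<lambda>(s, x). horocycle_flow s x) \<circ> (\<lambda>(s, u). (s, ?p u)))"
    by (rule continuous_map_eq) (auto simp: horocycle_flow_coset[OF \<Gamma>])
  then show ?thesis
    using continuous_compose_quotient_map[OF quotient_map_prod_open[OF i q]] by blast
qed

lemma horocycle_flow_add:
  assumes \<Gamma>: "subgroup \<Gamma> PSL2R" and x: "x \<in> topspace (T1 \<Gamma>)"
  shows "horocycle_flow (s + t) x = horocycle_flow s (horocycle_flow t x)"
proof -
  obtain u where "u \<in> carrier PSL2R" "x = \<Gamma> #>\<^bsub>PSL2R\<^esub> u"
    using x by (auto simp: topspace_T1 RCOSETS_def)
  then show ?thesis
    using horo_elt_in_carrier
    by (simp add: horocycle_flow_coset[OF \<Gamma>] horo_elt_add PSL.m_assoc add.commute[of s t])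
qed

lemma horocycle_flow_0:
  assumes \<Gamma>: "subgroup \<Gamma> PSL2R" and x: "x \<in> topspace (T1 \<Gamma>)"
  shows "horocycle_flow 0 x = x"
proof -
  obtain u where "u \<in> carrier PSL2R" "x = \<Gamma> #>\<^bsub>PSL2R\<^esub> u"
    using x by (auto simp: topspace_T1 RCOSETS_def)
  then show ?thesis
    by (simp add: horocycle_flow_coset[OF \<Gamma>] horo_elt_0)
qed

lemma continuous_covering:
  assumes "subgroup \<Gamma> PSL2R" "subgroup \<Gamma>' PSL2R" "\<Gamma>' \<subseteq> \<Gamma>"
  shows "continuous_map (T1 \<Gamma>') (T1 \<Gamma>) (covering \<Gamma>)"
proof (rule continuous_compose_quotient_map)
  show "quotient_map PSL2R_top (T1 \<Gamma>') (\<lambda>u. \<Gamma>' #>\<^bsub>PSL2R\<^esub> u)"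
    unfolding T1_def by (rule PSL.quotient_map_rcosets)
  have "continuous_map PSL2R_top (T1 \<Gamma>) (\<lambda>u. \<Gamma> #>\<^bsub>PSL2R\<^esub> u)"
    unfolding T1_def by (rule quotient_imp_continuous_map[OF PSL.quotient_map_rcosets])
  then show "continuous_map PSL2R_top (T1 \<Gamma>) (covering \<Gamma> \<circ> (\<lambda>u. \<Gamma>' #>\<^bsub>PSL2R\<^esub> u))"
    by (rule continuous_map_eq) (simp add: covering_coset[OF assms])
qed

lemma covering_horocycle_flow:
  assumes \<Gamma>: "subgroup \<Gamma> PSL2R" and \<Gamma>': "subgroup \<Gamma>' PSL2R" and sub: "\<Gamma>' \<subseteq> \<Gamma>" and x: "x \<in> topspace (T1 \<Gamma>')"
  shows "covering \<Gamma> (horocycle_flow s x) = horocycle_flow s (covering \<Gamma> x)"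
proof -
  obtain u where "u \<in> carrier PSL2R" "x = \<Gamma>' #>\<^bsub>PSL2R\<^esub> u"
    using x by (auto simp: topspace_T1 RCOSETS_def)
  then show ?thesis
    using horo_elt_in_carrier
    by (simp add: horocycle_flow_coset[OF \<Gamma>] horocycle_flow_coset[OF \<Gamma>'] covering_coset[OF \<Gamma> \<Gamma>' sub])
qed

section \<open>Periods and stabilizers of endpoints\<close>

text \<open>The infimum \<open>T\<close> of the positive elements is attained, since two distinct elements near it would
have a difference smaller than \<open>\<epsilon>\<close>; reducing any element modulo \<open>T\<close> then leaves remainder zero.\<close>

lemma discrete_additive_subgroup_real:
  fixes P :: "real set"
  assumes diff: "\<And>a b. a \<in> P \<Longrightarrow> b \<in> P \<Longrightarrow> a - b \<in> P"
    and isolated: "\<epsilon> > 0" "\<And>a. a \<in> P \<Longrightarrow> \<bar>a\<bar> < \<epsilon> \<Longrightarrow> a = 0"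
    and nontrivial: "t \<in> P" "t > 0"
  shows "\<exists>T>0. \<forall>s. s \<in> P \<longleftrightarrow> (\<exists>k::int. s = k * T)"
proof -
  let ?Q = "{a \<in> P. a > 0}"
  define T where "T = Inf ?Q"
  have ne: "?Q \<noteq> {}" using nontrivial by blast
  have bdd: "bdd_below ?Q" by (rule bdd_belowI[of _ 0]) auto
  have lower: "T \<le> a" if "a \<in> ?Q" for a unfolding T_def using that bdd by (rule cInf_lower)
  obtain a where a: "a \<in> ?Q" "a < T + \<epsilon>"
    using cInf_lessD[OF ne, of "T + \<epsilon>"] isolated(1) unfolding T_def by auto
  have "a = T"
  proof (rule ccontr)
    assume "a \<noteq> T"
    then obtain b where b: "b \<in> ?Q" "b < a"
      using cInf_lessD[OF ne, of a] lower[OF a(1)] unfolding T_def by auto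
    have "a - b \<in> P" "\<bar>a - b\<bar> < \<epsilon>" using a b diff lower[OF b(1)] by auto
    then show False using isolated(2) b(2) by fastforce
  qed
  then have T: "T \<in> P" "T > 0" using a by auto
  have zero: "0 \<in> P" using diff[OF T(1) T(1)] by simp
  have uminus_mem: "- s \<in> P" if "s \<in> P" for s using diff[OF zero that] by simp
  have add: "r + s \<in> P" if "r \<in> P" "s \<in> P" for r s using diff[OF that(1) uminus_mem[OF that(2)]] by simp
  have nmult: "real n * T \<in> P" for n
    by (induction n) (use zero add T in \<open>auto simp: distrib_right\<close>)
  have mult: "of_int k * T \<in> P" for k :: int
  proof (cases k)
    case (nonneg n)
    then show ?thesis using nmult by simp
  next
    case (neg n)
    have "- (real (Suc n) * T) \<in> P" using nmult uminus_mem by blast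
    moreover have "of_int k = - real (Suc n)" using neg by simp
    ultimately show ?thesis by (simp only: mult_minus_left)
  qed
  have "\<exists>k::int. s = k * T" if "s \<in> P" for s
  proof -
    obtain k :: int where k: "0 \<le> s - k * T" "s - k * T < T"
      using T(2) by (rule reduce_modulo_period)
    have "s - k * T \<in> P" using that mult diff by blast
    then have "s - k * T = 0" using lower[of "s - k * T"] k by force
    then show ?thesis by (intro exI[of _ k]) simp
  qed
  then show ?thesis using T(2) mult by blast
qed

lemma psl_classE:
  assumes "g \<in> carrier PSL2R"
  obtains A where "det A = 1" "g = psl_class A"
  using assms unfolding carrier_PSL2R by blast

text \<open>Forward endpoints are images of \<open>\<infinity>\<close>, so this instance of the action property describes how group
elements move them.\<close>

lemma moebius_mult_None:
  assumes "det A = 1" "det B = 1"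
  shows "moebius (A ** B) None = moebius A (moebius B None)"
proof -
  have e: "(A ** B)$i$1 = A$i$1 * B$1$1 + A$i$2 * B$2$1" for i
    by (simp add: matrix_matrix_mult_def UNIV_2)
  show ?thesis
  proof (cases "B$2$1 = 0")
    case True
    then have "B$1$1 \<noteq> 0" using assms(2) by (auto simp: det_2)
    then show ?thesis using True by (simp add: moebius_def e)
  next
    case False
    have "A$2$1 * B$1$1 + A$2$2 * B$2$1 = B$2$1 * (A$2$1 * (B$1$1 / B$2$1) + A$2$2)"
      "A$1$1 * B$1$1 + A$1$2 * B$2$1 = B$2$1 * (A$1$1 * (B$1$1 / B$2$1) + A$1$2)"
      using False by (simp_all add: field_simps)
    then show ?thesis using False by (simp add: moebius_def e)
  qed
qed

lemma forward_endpoint_mult: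
  assumes "a \<in> carrier PSL2R" "b \<in> carrier PSL2R"
  shows "forward_endpoint (a \<otimes>\<^bsub>PSL2R\<^esub> b) = psl_act a (forward_endpoint b)"
proof -
  obtain A B where "det A = 1" "a = psl_class A" "det B = 1" "b = psl_class B"
    using assms by (metis psl_classE)
  then show ?thesis
    by (simp add: forward_endpoint_def mult_PSL2R psl_act_class moebius_mult_None)
qed

lemma forward_endpoint_horo:
  assumes "a \<in> carrier PSL2R"
  shows "forward_endpoint (a \<otimes>\<^bsub>PSL2R\<^esub> horo_elt s) = forward_endpoint a"
proof -
  have "forward_endpoint (horo_elt s) = None"
    by (simp add: forward_endpoint_def horo_elt_def psl_act_class moebius_def)
  then show ?thesis
    using assms horo_elt_in_carrier by (simp add: forward_endpoint_mult) (simp add: forward_endpoint_def)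
qed

lemma forward_endpoint_eq_imp:
  assumes ab: "a \<in> carrier PSL2R" "b \<in> carrier PSL2R" and eq: "forward_endpoint a = forward_endpoint b"
  shows "forward_endpoint (inv\<^bsub>PSL2R\<^esub> a \<otimes>\<^bsub>PSL2R\<^esub> b) = None"
proof -
  have "forward_endpoint (inv\<^bsub>PSL2R\<^esub> a \<otimes>\<^bsub>PSL2R\<^esub> b) = forward_endpoint (inv\<^bsub>PSL2R\<^esub> a \<otimes>\<^bsub>PSL2R\<^esub> a)"
    using forward_endpoint_mult[of "inv\<^bsub>PSL2R\<^esub> a" a] forward_endpoint_mult[of "inv\<^bsub>PSL2R\<^esub> a" b] ab eq
    by (metis PSL.inv_closed)
  also have "\<dots> = None"
    using ab(1) by (simp add: one_PSL2R forward_endpoint_def psl_act_class moebius_def mat_def)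
  finally show ?thesis .
qed

text \<open>An element fixing \<open>\<infinity>\<close> is upper triangular with diagonal entries \<open>\<alpha>\<close> and \<open>1/\<alpha>\<close>. It normalises the
unipotent group, scaling the parameter by \<open>a = \<alpha>\<^sup>2\<close>. In PSL(2,R) the sign of \<open>\<alpha>\<close> is lost, so \<open>a = 1\<close>
already makes the element unipotent.\<close>

lemma borel_cases:
  assumes "b \<in> carrier PSL2R" "forward_endpoint b = None"
  obtains a where "a > 0" "\<And>s. b \<otimes>\<^bsub>PSL2R\<^esub> horo_elt s = horo_elt (a * s) \<otimes>\<^bsub>PSL2R\<^esub> b"
    "a = 1 \<Longrightarrow> \<exists>r. b = horo_elt r"
proof -
  obtain A where A: "det A = 1" "b = psl_class A" using assms(1) by (rule psl_classE)
  have 21: "A$2$1 = 0"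
    using assms(2) by (simp add: A(2) forward_endpoint_def psl_act_class moebius_def split: if_splits)
  then have 11: "A$1$1 * A$2$2 = 1" using A(1) by (simp add: det_2)
  show thesis
  proof (rule that[of "(A$1$1)\<^sup>2"])
    show "(A$1$1)\<^sup>2 > 0" using 11 by auto
    show "b \<otimes>\<^bsub>PSL2R\<^esub> horo_elt s = horo_elt ((A$1$1)\<^sup>2 * s) \<otimes>\<^bsub>PSL2R\<^esub> b" for s
    proof -
      have "A ** vector [vector [1, s], vector [0, 1]] =
          (vector [vector [1, (A$1$1)\<^sup>2 * s], vector [0, 1]] :: real^2^2) ** A"
        using 21 11 by (simp add: vec_eq_iff matrix_matrix_mult_def UNIV_2 forall_2 power2_eq_square algebra_simps)
      moreover have "det (vector [vector [1, t], vector [0, 1]] :: real^2^2) = 1" for t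
        by (simp add: det_2)
      ultimately show ?thesis by (simp add: A horo_elt_def mult_PSL2R)
    qed
    assume "(A$1$1)\<^sup>2 = 1"
    then have "A$1$1 = 1 \<and> A$2$2 = 1 \<or> A$1$1 = -1 \<and> A$2$2 = -1"
      using 11 by (auto simp: power2_eq_1_iff)
    then have "A = vector [vector [1, A$1$2], vector [0, 1]] \<or>
        A = - vector [vector [1, - A$1$2], vector [0, 1]]"
      using 21 by (auto simp: vec_eq_iff forall_2)
    then show "\<exists>r. b = horo_elt r"
      unfolding A(2) horo_elt_def by (metis psl_class_uminus)
  qed
qed

lemma parabolic_conjugate_horo:
  assumes v: "v \<in> carrier PSL2R" and s: "s \<noteq> 0"
  shows "parabolic (v \<otimes>\<^bsub>PSL2R\<^esub> horo_elt s \<otimes>\<^bsub>PSL2R\<^esub> inv\<^bsub>PSL2R\<^esub> v)" (is "parabolic ?g")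
  unfolding parabolic_def
proof (intro conjI ballI)
  show c: "?g \<in> carrier PSL2R" using v horo_elt_in_carrier by simp
  show "?g \<noteq> \<one>\<^bsub>PSL2R\<^esub>"
  proof
    assume "?g = \<one>\<^bsub>PSL2R\<^esub>"
    then have "v \<otimes>\<^bsub>PSL2R\<^esub> horo_elt s = v"
      using v horo_elt_in_carrier by (metis PSL.inv_closed PSL.inv_equality PSL.inv_inv PSL.m_closed)
    then have "horo_elt s = \<one>\<^bsub>PSL2R\<^esub>"
      using v horo_elt_in_carrier by simp
    then show False using s by (simp add: horo_elt_eq_one)
  qed
  obtain A where A: "det A = 1" "v = psl_class A" using v by (rule psl_classE)
  let ?H = "vector [vector [1, s], vector [0, 1]] :: real^2^2"
  have g: "?g = psl_class ((A ** ?H) ** adjugate A)"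
    by (simp add: A horo_elt_def inv_PSL2R mult_PSL2R det_2[of ?H] det_mul det_adjugate)
  have "trace ((A ** ?H) ** adjugate A) = trace (adjugate A ** (A ** ?H))" by (rule trace_mul_sym)
  also have "\<dots> = trace ?H" by (simp add: matrix_mul_assoc adjugate_mult A)
  also have "\<dots> = 2" by (simp add: trace_def UNIV_2)
  finally have tr: "trace ((A ** ?H) ** adjugate A) = 2" .
  fix B assume "B \<in> ?g"
  then have "B = (A ** ?H) ** adjugate A \<or> B = - ((A ** ?H) ** adjugate A)"
    unfolding g psl_class_eq by blast
  then show "\<bar>trace B\<bar> = 2" using tr by (auto simp: trace_def sum_negf)
qed

section \<open>The tower over a closed horocycle\<close>

locale periodic_horocycle_tower =
  fixes \<Gamma> :: "(real^2^2) set set" and G :: "nat \<Rightarrow> (real^2^2) set set"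
    and u :: "(real^2^2) set"
  assumes \<Gamma>: "subgroup \<Gamma> PSL2R"
    and discrete: "subtopology PSL2R_top \<Gamma> = discrete_topology \<Gamma>"
    and G_0: "G 0 = \<Gamma>"
    and G: "\<And>n. subgroup (G n) PSL2R"
    and G_decreasing: "\<And>n. G (Suc n) \<subseteq> G n"
    and G_finite_index: "\<And>n. finite ((\<lambda>\<gamma>. G n #>\<^bsub>PSL2R\<^esub> \<gamma>) ` \<Gamma>)"
    and u: "u \<in> carrier PSL2R"
    and periodic: "horo_periodic (\<Gamma> #>\<^bsub>PSL2R\<^esub> u)"
begin

abbreviation mult (infixl \<open>\<cdot>\<close> 70) where "a \<cdot> b \<equiv> a \<otimes>\<^bsub>PSL2R\<^esub> b"
abbreviation coset (infixl \<open>\<diamondop>\<close> 60) where "H \<diamondop> a \<equiv> H #>\<^bsub>PSL2R\<^esub> a"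

definition base :: "(real^2^2) set set" where "base = \<Gamma> \<diamondop> u"

definition M :: "(nat \<Rightarrow> (real^2^2) set set) set" where
  "M = {y \<in> topspace (tower_limit G). y 0 \<in> flow_orbit horocycle_flow base}"

lemma G_antimono: "m \<le> n \<Longrightarrow> G n \<subseteq> G m"
  using lift_Suc_antimono_le[of G] G_decreasing by blast

lemma G_subset: "G n \<subseteq> \<Gamma>"
  using G_antimono[of 0 n] G_0 by simp

lemma \<Gamma>_carrier: "g \<in> \<Gamma> \<Longrightarrow> g \<in> carrier PSL2R"
  using \<Gamma> by (rule subgroup.mem_carrier)

lemma G_\<Gamma>: "g \<in> G n \<Longrightarrow> g \<in> \<Gamma>"
  using G_subset by blast

lemma Hausdorff_T1: "Hausdorff_space (T1 (G n))"
proof -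
  have "subtopology PSL2R_top (G n) = subtopology (subtopology PSL2R_top \<Gamma>) (G n)"
    using G_subset[of n] by (simp add: subtopology_subtopology Int_absorb1)
  also have "\<dots> = discrete_topology (G n)"
    using G_subset[of n] by (simp add: discrete Int_absorb1)
  finally show ?thesis
    unfolding T1_def by (rule PSL.Hausdorff_space_rcosets[OF G])
qed

lemma T1_cases:
  assumes "w \<in> topspace (T1 (G n))"
  obtains v where "v \<in> carrier PSL2R" "w = G n \<diamondop> v"
  using assms by (auto simp: topspace_T1 RCOSETS_def)

lemma coset_in_T1: "v \<in> carrier PSL2R \<Longrightarrow> G n \<diamondop> v \<in> topspace (T1 (G n))"
  by (auto simp: topspace_T1 RCOSETS_def)

lemma topspace_tower:
  "topspace (tower_limit G) =
     {y. \<forall>n. y n \<in> topspace (T1 (G n)) \<and> covering (G n) (y (Suc n)) = y n}"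
  by (auto simp: tower_limit_def PiE_UNIV_domain)

lemma thread_descends:
  assumes "y \<in> topspace (tower_limit G)" "y n = G n \<diamondop> v" "v \<in> carrier PSL2R" "m \<le> n"
  shows "y m = G m \<diamondop> v"
  using assms(4,2)
proof (induction rule: inc_induct)
  case base then show ?case .
next
  case (step k)
  have "y k = covering (G k) (y (Suc k))" using assms(1) by (simp add: topspace_tower)
  also have "y (Suc k) = G (Suc k) \<diamondop> v" using step by simp
  also have "covering (G k) (G (Suc k) \<diamondop> v) = G k \<diamondop> v"
    by (rule covering_coset[OF G G G_decreasing assms(3)])
  finally show ?case using step by simp
qed

lemma thread_agree:
  assumes "w \<in> topspace (tower_limit G)" "z \<in> topspace (tower_limit G)" "w n = z n" "m \<le> n"
  shows "w m = z m"
proof -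
  have "z n \<in> topspace (T1 (G n))" using assms(2) by (simp add: topspace_tower)
  then obtain v where "v \<in> carrier PSL2R" "z n = G n \<diamondop> v" by (rule T1_cases)
  then show ?thesis using thread_descends assms by metis
qed

lemma const_thread: "v \<in> carrier PSL2R \<Longrightarrow> (\<lambda>n. G n \<diamondop> v) \<in> topspace (tower_limit G)"
  by (simp add: topspace_tower coset_in_T1 covering_coset[OF G G G_decreasing])

lemma horocycle_flow_T1:
  "w \<in> topspace (T1 (G n)) \<Longrightarrow> horocycle_flow s w \<in> topspace (T1 (G n))"
  by (metis G PSL.m_closed T1_cases coset_in_T1 horo_elt_in_carrier horocycle_flow_coset)

lemma limit_flow_tower:
  "y \<in> topspace (tower_limit G) \<Longrightarrow> limit_flow s y \<in> topspace (tower_limit G)"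
  by (simp add: topspace_tower limit_flow_def horocycle_flow_T1
      covering_horocycle_flow[OF G G G_decreasing])

lemma limit_flow_0: "y \<in> topspace (tower_limit G) \<Longrightarrow> limit_flow 0 y = y"
  using horocycle_flow_0[OF G] unfolding topspace_tower limit_flow_def by blast

lemma limit_flow_add:
  "y \<in> topspace (tower_limit G) \<Longrightarrow> limit_flow (s + t) y = limit_flow s (limit_flow t y)"
  using horocycle_flow_add[OF G] unfolding topspace_tower limit_flow_def by blast

lemma Hausdorff_tower: "Hausdorff_space (tower_limit G)"
  unfolding tower_limit_def
  by (simp add: Hausdorff_space_subtopology Hausdorff_space_product_topology Hausdorff_T1)

lemma continuous_coordinate: "continuous_map (tower_limit G) (T1 (G n)) (\<lambda>y. y n)"
  unfolding tower_limit_def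
  by (intro continuous_map_from_subtopology continuous_map_product_projection) simp

lemma continuous_limit_flow:
  "continuous_map (prod_topology euclideanreal (tower_limit G)) (tower_limit G) (\<lambda>(s, y). limit_flow s y)"
proof -
  let ?X = "prod_topology euclideanreal (tower_limit G)"
  have "continuous_map ?X (T1 (G n)) (\<lambda>p. horocycle_flow (fst p) (snd p n))" for n
  proof -
    have "continuous_map ?X (T1 (G n)) (\<lambda>p. snd p n)"
      using continuous_map_compose[OF continuous_map_snd continuous_coordinate] by (simp add: o_def)
    then have "continuous_map ?X (prod_topology euclideanreal (T1 (G n))) (\<lambda>p. (fst p, snd p n))"
      by (intro continuous_map_pairedI continuous_map_fst)
    from continuous_map_compose[OF this continuous_horocycle_flow[OF G]]
    show ?thesis by (simp add: o_def)
  qed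
  then have "continuous_map ?X (product_topology (\<lambda>n. T1 (G n)) UNIV) (\<lambda>(s, y). limit_flow s y)"
    unfolding continuous_map_componentwise_UNIV by (simp add: limit_flow_def case_prod_unfold)
  moreover have "covering (G n) (limit_flow s y (Suc n)) = limit_flow s y n"
    if "y \<in> topspace (tower_limit G)" for s y n
    using limit_flow_tower[OF that] by (simp add: topspace_tower)
  ultimately show ?thesis
    by (subst (2) tower_limit_def) (auto simp: continuous_map_in_subtopology)
qed

lemma base_flow: "horocycle_flow s base = \<Gamma> \<diamondop> (u \<cdot> horo_elt s)"
  unfolding base_def by (rule horocycle_flow_coset[OF \<Gamma> u])

lemma period_iff: "horocycle_flow s base = base \<longleftrightarrow> u \<cdot> horo_elt s \<cdot> inv\<^bsub>PSL2R\<^esub> u \<in> \<Gamma>"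
  unfolding base_flow unfolding base_def
  by (rule PSL.rcoset_eq_iff[OF \<Gamma>]) (use u horo_elt_in_carrier in auto)

text \<open>The periods \<open>s\<close> of the base point are the parameters with \<open>u h\<^sub>s u\<inverse> \<in> \<Gamma>\<close>. They form a subgroup of the
line in which 0 is isolated, because \<open>\<Gamma>\<close> is discrete and \<open>s \<mapsto> u h\<^sub>s u\<inverse>\<close> is continuous and injective.\<close>

lemma minimal_period_exists: "\<exists>T>0. \<forall>s. horocycle_flow s base = base \<longleftrightarrow> (\<exists>k::int. s = k * T)"
proof -
  let ?c = "\<lambda>s. u \<cdot> horo_elt s \<cdot> inv\<^bsub>PSL2R\<^esub> u"
  let ?P = "{s. horocycle_flow s base = base}"
  have diff: "s - t \<in> ?P" if "s \<in> ?P" "t \<in> ?P" for s t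
    using that subgroup.m_closed[OF \<Gamma>] subgroup.m_inv_closed[OF \<Gamma>]
    by (simp add: period_iff conj_horo_diff[OF u])
  have "openin (subtopology PSL2R_top \<Gamma>) {\<one>\<^bsub>PSL2R\<^esub>}"
    unfolding discrete using subgroup.one_closed[OF \<Gamma>] by simp
  then obtain V where V: "openin PSL2R_top V" "V \<inter> \<Gamma> = {\<one>\<^bsub>PSL2R\<^esub>}"
    unfolding openin_subtopology by blast
  have "continuous_map euclideanreal PSL2R_top ?c"
    by (intro PSL.continuous_mult' continuous_horo_elt) (use u in auto)
  then have "openin euclideanreal {s \<in> topspace euclideanreal. ?c s \<in> V}"
    using V(1) by (rule openin_continuous_map_preimage)
  then have "open {s. ?c s \<in> V}" by simp
  moreover have "0 \<in> {s. ?c s \<in> V}" using u V(2) by (auto simp: horo_elt_0)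
  ultimately obtain e where e: "e > 0" "\<And>s. \<bar>s\<bar> < e \<Longrightarrow> ?c s \<in> V"
    unfolding open_dist by (force simp: dist_real_def)
  have isolated: "s = 0" if "s \<in> ?P" "\<bar>s\<bar> < e" for s
  proof -
    have "?c s = \<one>\<^bsub>PSL2R\<^esub>" using that e(2) V(2) by (auto simp: period_iff)
    then have "u \<cdot> horo_elt s = u"
      using u horo_elt_in_carrier by (metis PSL.inv_closed PSL.inv_equality PSL.inv_inv PSL.m_closed)
    then show ?thesis using u horo_elt_in_carrier by (simp add: horo_elt_eq_one)
  qed
  obtain t where t: "t > 0" "t \<in> ?P" using periodic unfolding horo_periodic_def base_def by blast
  have "\<exists>T>0. \<forall>s. s \<in> ?P \<longleftrightarrow> (\<exists>k::int. s = k * T)"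
    using diff e(1) isolated t(2,1) by (rule discrete_additive_subgroup_real)
  then show ?thesis by simp
qed

definition T :: real where
  "T = (SOME T. T > 0 \<and> (\<forall>s. horocycle_flow s base = base \<longleftrightarrow> (\<exists>k::int. s = k * T)))"

lemma T_pos: "T > 0" and T_period: "horocycle_flow s base = base \<longleftrightarrow> (\<exists>k::int. s = k * T)"
proof -
  have "T > 0 \<and> (\<forall>s. horocycle_flow s base = base \<longleftrightarrow> (\<exists>k::int. s = k * T))"
    unfolding T_def using minimal_period_exists by (rule someI_ex)
  then show "T > 0" "horocycle_flow s base = base \<longleftrightarrow> (\<exists>k::int. s = k * T)" by auto
qed

lemma conj_period_in_\<Gamma>: "u \<cdot> horo_elt s \<cdot> inv\<^bsub>PSL2R\<^esub> u \<in> \<Gamma> \<longleftrightarrow> (\<exists>k::int. s = k * T)"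
  using period_iff T_period by simp

section \<open>Cusps are horocycle orbits\<close>

text \<open>The element \<open>b = u\<inverse> \<delta> u\<close> fixes \<open>\<infinity>\<close>, so conjugation by it scales the unipotent parameter by some \<open>a > 0\<close>.
As \<open>\<delta>\<close> lies in \<open>\<Gamma>\<close>, multiplication by \<open>a\<close> preserves the group of periods \<open>T\<int>\<close> in both directions.
Thus \<open>a\<close> and \<open>1/a\<close> are integers, \<open>a = 1\<close>, and \<open>b\<close> is unipotent. This is the fact that a cusp of a
discrete group is not fixed by a hyperbolic element.\<close>

lemma endpoint_stabilizer:
  assumes \<delta>: "\<delta> \<in> \<Gamma>" and fix_end: "forward_endpoint (\<delta> \<cdot> u) = forward_endpoint u"
  shows "\<exists>r. \<delta> \<cdot> u = u \<cdot> horo_elt r"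
proof -
  note [simp] = u horo_elt_in_carrier \<Gamma>_carrier[OF \<delta>]
  define b where "b = inv\<^bsub>PSL2R\<^esub> u \<cdot> (\<delta> \<cdot> u)"
  have b: "b \<in> carrier PSL2R" by (simp add: b_def)
  have ub: "u \<cdot> b = \<delta> \<cdot> u" by (simp add: b_def flip: PSL.m_assoc)
  have "forward_endpoint b = None"
    unfolding b_def by (rule forward_endpoint_eq_imp) (simp_all add: fix_end)
  then obtain a where a: "a > 0" "\<And>s. b \<cdot> horo_elt s = horo_elt (a * s) \<cdot> b"
      "a = 1 \<Longrightarrow> \<exists>r. b = horo_elt r"
    using borel_cases[OF b] by blast
  have conj: "\<delta> \<cdot> (u \<cdot> horo_elt s \<cdot> inv\<^bsub>PSL2R\<^esub> u) = (u \<cdot> horo_elt (a * s) \<cdot> inv\<^bsub>PSL2R\<^esub> u) \<cdot> \<delta>" for s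
  proof -
    have "\<delta> \<cdot> (u \<cdot> horo_elt s \<cdot> inv\<^bsub>PSL2R\<^esub> u) = (\<delta> \<cdot> u) \<cdot> horo_elt s \<cdot> inv\<^bsub>PSL2R\<^esub> u"
      by (simp add: PSL.m_assoc)
    also have "\<dots> = u \<cdot> (b \<cdot> horo_elt s) \<cdot> inv\<^bsub>PSL2R\<^esub> u"
      using b by (simp add: ub[symmetric] PSL.m_assoc)
    also have "\<dots> = u \<cdot> horo_elt (a * s) \<cdot> (b \<cdot> inv\<^bsub>PSL2R\<^esub> u)"
      using b by (simp add: a(2) PSL.m_assoc)
    also have "b \<cdot> inv\<^bsub>PSL2R\<^esub> u = inv\<^bsub>PSL2R\<^esub> u \<cdot> \<delta>"
      by (simp add: b_def PSL.m_assoc)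
    finally show ?thesis by (simp add: PSL.m_assoc)
  qed
  have mem: "u \<cdot> horo_elt (a * s) \<cdot> inv\<^bsub>PSL2R\<^esub> u \<in> \<Gamma> \<longleftrightarrow> u \<cdot> horo_elt s \<cdot> inv\<^bsub>PSL2R\<^esub> u \<in> \<Gamma>" (is "?p \<in> \<Gamma> \<longleftrightarrow> ?q \<in> \<Gamma>") for s
  proof -
    have "?p = \<delta> \<cdot> ?q \<cdot> inv\<^bsub>PSL2R\<^esub> \<delta>" "?q = inv\<^bsub>PSL2R\<^esub> \<delta> \<cdot> ?p \<cdot> \<delta>"
      using conj[of s] by (simp_all add: PSL.inv_solve_right' PSL.inv_solve_left PSL.m_assoc)
    then show ?thesis
      using \<delta> \<Gamma> by (metis subgroup.m_closed subgroup.m_inv_closed)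
  qed
  obtain k :: int where k: "a * T = k * T" using mem[of T] conj_period_in_\<Gamma> by (metis mult_1 of_int_1)
  have "u \<cdot> horo_elt (a * (T / a)) \<cdot> inv\<^bsub>PSL2R\<^esub> u \<in> \<Gamma>"
    using a(1) conj_period_in_\<Gamma>[of T] by (metis mult_1 of_int_1 nonzero_mult_div_cancel_left times_divide_eq_right less_irrefl)
  then obtain l :: int where l: "T / a = l * T" using mem conj_period_in_\<Gamma> by blast
  have ak: "a = of_int k" using k T_pos by simp
  have "1 = of_int l * a" using l a(1) T_pos by (simp add: field_simps)
  then have "1 = l * k" unfolding ak by (metis of_int_eq_1_iff of_int_mult)
  moreover have "k > 0" using a(1) ak by simp
  ultimately have "k = 1" by (metis zmult_eq_1_iff less_irrefl zero_less_one neg_0_less_iff_less not_one_less_zero)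
  then obtain r where "b = horo_elt r" using a(3) ak by auto
  then show ?thesis using ub by auto
qed

lemma same_endpoint_imp_same_orbit:
  assumes \<gamma>: "\<gamma> \<in> \<Gamma>" "\<gamma>' \<in> \<Gamma>" and eq: "forward_endpoint (\<gamma> \<cdot> u) = forward_endpoint (\<gamma>' \<cdot> u)"
  shows "\<exists>r. \<gamma>' \<cdot> u = \<gamma> \<cdot> u \<cdot> horo_elt r"
proof -
  note [simp] = u horo_elt_in_carrier \<Gamma>_carrier[OF \<gamma>(1)] \<Gamma>_carrier[OF \<gamma>(2)]
  have \<delta>: "inv\<^bsub>PSL2R\<^esub> \<gamma> \<cdot> \<gamma>' \<in> \<Gamma>" using \<gamma> \<Gamma> by (simp add: subgroup.m_closed subgroup.m_inv_closed)
  have "forward_endpoint (inv\<^bsub>PSL2R\<^esub> \<gamma> \<cdot> \<gamma>' \<cdot> u) = psl_act (inv\<^bsub>PSL2R\<^esub> \<gamma>) (forward_endpoint (\<gamma>' \<cdot> u))"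
    by (simp add: PSL.m_assoc forward_endpoint_mult[symmetric])
  also have "\<dots> = forward_endpoint (inv\<^bsub>PSL2R\<^esub> \<gamma> \<cdot> (\<gamma> \<cdot> u))"
    unfolding eq[symmetric] by (simp add: forward_endpoint_mult[symmetric])
  also have "\<dots> = forward_endpoint u" by (simp flip: PSL.m_assoc)
  finally obtain r where "inv\<^bsub>PSL2R\<^esub> \<gamma> \<cdot> \<gamma>' \<cdot> u = u \<cdot> horo_elt r"
    using endpoint_stabilizer[OF \<delta>] by blast
  then have "\<gamma> \<cdot> (inv\<^bsub>PSL2R\<^esub> \<gamma> \<cdot> \<gamma>' \<cdot> u) = \<gamma> \<cdot> (u \<cdot> horo_elt r)" by simp
  then have "\<gamma>' \<cdot> u = \<gamma> \<cdot> u \<cdot> horo_elt r" by (simp flip: PSL.m_assoc)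
  then show ?thesis ..
qed

text \<open>On a coset \<open>w = G\<^sub>n v\<close> this is the \<open>G\<^sub>n\<close>-orbit of the forward endpoint of \<open>v\<close>; taking the image of the
whole coset avoids choosing \<open>v\<close> and naming \<open>n\<close>.\<close>

definition cusp :: "(real^2^2) set set \<Rightarrow> real option set" where
  "cusp w = forward_endpoint ` w"

definition cusps_at :: "nat \<Rightarrow> real option set set" where
  "cusps_at n = (\<lambda>y. cusp (y n)) ` M"

lemma cusp_coset: "v \<in> carrier PSL2R \<Longrightarrow> cusp (G n \<diamondop> v) = boundary_orbit (G n) (forward_endpoint v)"
  unfolding cusp_def boundary_orbit_def r_coset_def image_UN
  using G_\<Gamma> \<Gamma>_carrier by (auto simp: forward_endpoint_mult image_iff)

text \<open>The time \<open>s\<close> is read off at level 0 and serves all levels at once.\<close>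

lemma M_coordinates:
  assumes "y \<in> M"
  obtains s where "\<And>n. \<exists>\<gamma>\<in>\<Gamma>. y n = G n \<diamondop> (\<gamma> \<cdot> u \<cdot> horo_elt s)"
proof -
  note [simp] = u horo_elt_in_carrier
  have y: "y \<in> topspace (tower_limit G)" using assms by (simp add: M_def)
  obtain s where s: "y 0 = \<Gamma> \<diamondop> (u \<cdot> horo_elt s)"
    using assms base_flow by (auto simp: M_def flow_orbit_def)
  show thesis
  proof (rule that[of s])
    fix n
    have "y n \<in> topspace (T1 (G n))" using y by (simp add: topspace_tower)
    then obtain v where v: "v \<in> carrier PSL2R" "y n = G n \<diamondop> v" by (rule T1_cases)
    have "\<Gamma> \<diamondop> v = \<Gamma> \<diamondop> (u \<cdot> horo_elt s)"
      using thread_descends[OF y v(2,1), of 0] s by (simp add: G_0)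
    then have "v \<in> \<Gamma> \<diamondop> (u \<cdot> horo_elt s)"
      using PSL.rcos_self[OF v(1) \<Gamma>] by simp
    then obtain \<gamma> where "\<gamma> \<in> \<Gamma>" "v = \<gamma> \<cdot> (u \<cdot> horo_elt s)" unfolding r_coset_def by blast
    then show "\<exists>\<gamma>\<in>\<Gamma>. y n = G n \<diamondop> (\<gamma> \<cdot> u \<cdot> horo_elt s)"
      using v(2) by (auto simp: PSL.m_assoc \<Gamma>_carrier intro!: bexI[of _ \<gamma>])
  qed
qed

text \<open>The forward endpoint is constant along horocycle orbits. Conversely, equal cusps mean that
representatives \<open>\<gamma> u h\<^sub>s\<close> and \<open>\<gamma>' u h\<^sub>t\<close> have the same endpoint after multiplying one of them by an
element of \<open>G\<^sub>n\<close>, and \<open>same_endpoint_imp_same_orbit\<close> applies.\<close>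

lemma cusp_eq_iff_same_orbit:
  assumes "y \<in> M" "z \<in> M"
  shows "cusp (y n) = cusp (z n) \<longleftrightarrow> (\<exists>r. z n = horocycle_flow r (y n))"
proof -
  note [simp] = u horo_elt_in_carrier
  obtain s \<gamma> where y: "\<gamma> \<in> \<Gamma>" "y n = G n \<diamondop> (\<gamma> \<cdot> u \<cdot> horo_elt s)"
    using M_coordinates[OF assms(1)] by metis
  obtain t \<gamma>' where z: "\<gamma>' \<in> \<Gamma>" "z n = G n \<diamondop> (\<gamma>' \<cdot> u \<cdot> horo_elt t)"
    using M_coordinates[OF assms(2)] by metis
  note [simp] = \<Gamma>_carrier[OF y(1)] \<Gamma>_carrier[OF z(1)]
  show ?thesis
  proof
    assume "\<exists>r. z n = horocycle_flow r (y n)"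
    then obtain r where "z n = G n \<diamondop> (\<gamma> \<cdot> u \<cdot> horo_elt s \<cdot> horo_elt r)"
      using y(2) horocycle_flow_coset[OF G] by auto
    then show "cusp (y n) = cusp (z n)"
      using y(2) by (simp add: cusp_coset forward_endpoint_horo)
  next
    assume "cusp (y n) = cusp (z n)"
    moreover have "forward_endpoint (\<gamma>' \<cdot> u \<cdot> horo_elt t) \<in> cusp (z n)"
      unfolding z(2) cusp_def by (intro imageI PSL.rcos_self G) simp
    ultimately have "forward_endpoint (\<gamma>' \<cdot> u) \<in> boundary_orbit (G n) (forward_endpoint (\<gamma> \<cdot> u))"
      using y(2) by (simp add: cusp_coset forward_endpoint_horo)
    then obtain g where g: "g \<in> G n" "forward_endpoint (\<gamma>' \<cdot> u) = psl_act g (forward_endpoint (\<gamma> \<cdot> u))"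
      unfolding boundary_orbit_def by blast
    note [simp] = \<Gamma>_carrier[OF G_\<Gamma>[OF g(1)]]
    have "forward_endpoint (g \<cdot> \<gamma> \<cdot> u) = forward_endpoint (\<gamma>' \<cdot> u)"
      using g(2) by (simp add: forward_endpoint_mult[symmetric] PSL.m_assoc)
    moreover have "g \<cdot> \<gamma> \<in> \<Gamma>" using \<Gamma> G_\<Gamma>[OF g(1)] y(1) by (rule subgroup.m_closed)
    ultimately obtain r where r: "\<gamma>' \<cdot> u = g \<cdot> \<gamma> \<cdot> u \<cdot> horo_elt r"
      using same_endpoint_imp_same_orbit z(1) by blast
    have t: "horo_elt t = horo_elt s \<cdot> horo_elt (t - s)" using horo_elt_add[of s "t - s"] by simp
    have h: "horo_elt r \<cdot> horo_elt t = horo_elt s \<cdot> horo_elt (r + t - s)"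
      using horo_elt_add[of r t] horo_elt_add[of s "r + t - s"] by simp
    have "\<gamma>' \<cdot> u \<cdot> horo_elt t = g \<cdot> (\<gamma> \<cdot> u \<cdot> horo_elt s \<cdot> horo_elt (r + t - s))"
      unfolding r using h by (simp add: PSL.m_assoc)
    then have "z n = G n \<diamondop> (\<gamma> \<cdot> u \<cdot> horo_elt s \<cdot> horo_elt (r + t - s))"
      unfolding z(2) using g(1) PSL.coset_mult_assoc[OF subgroup.subset[OF G], of g]
        PSL.coset_join2[OF _ G g(1)] by (metis PSL.m_closed \<open>g \<in> carrier PSL2R\<close> \<open>\<gamma> \<in> carrier PSL2R\<close> u horo_elt_in_carrier)
    then show "\<exists>r. z n = horocycle_flow r (y n)"
      using y(2) horocycle_flow_coset[OF G] by auto
  qed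
qed

lemma M_tower: "y \<in> M \<Longrightarrow> y \<in> topspace (tower_limit G)"
  by (simp add: M_def)

lemma cusp_descends:
  assumes "y \<in> M" "z \<in> M" "cusp (y n) = cusp (z n)" "m \<le> n"
  shows "cusp (y m) = cusp (z m)"
proof -
  obtain r where r: "z n = horocycle_flow r (y n)"
    using cusp_eq_iff_same_orbit assms by blast
  have "z m = limit_flow r y m"
    by (rule thread_agree[OF M_tower limit_flow_tower[OF M_tower]])
      (use assms r in \<open>simp_all add: limit_flow_def\<close>)
  then show ?thesis
    using cusp_eq_iff_same_orbit assms unfolding limit_flow_def by blast
qed

text \<open>Constant sequences of representatives are threads, so every point at a finite level that lies over
the base point extends to a point of \<open>M\<close>.\<close>

lemma fibre_thread:
  assumes "\<gamma> \<in> \<Gamma>"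
  shows "(\<lambda>n. G n \<diamondop> (\<gamma> \<cdot> u)) \<in> M" and "G 0 \<diamondop> (\<gamma> \<cdot> u) = base"
proof -
  have "\<Gamma> \<diamondop> (\<gamma> \<cdot> u) = (\<Gamma> \<diamondop> \<gamma>) \<diamondop> u"
    using PSL.coset_mult_assoc[OF subgroup.subset[OF \<Gamma>]] u \<Gamma>_carrier[OF assms] by simp
  also have "\<Gamma> \<diamondop> \<gamma> = \<Gamma>"
    using PSL.coset_join2[OF _ \<Gamma> assms] \<Gamma>_carrier[OF assms] by simp
  finally show base: "G 0 \<diamondop> (\<gamma> \<cdot> u) = base" by (simp add: G_0 base_def)
  have "horocycle_flow 0 base = base"
    unfolding base_def using coset_in_T1[of u 0] u by (simp add: G_0 horocycle_flow_0[OF \<Gamma>])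
  then have "base \<in> flow_orbit horocycle_flow base"
    unfolding flow_orbit_def by (metis rangeI)
  then show "(\<lambda>n. G n \<diamondop> (\<gamma> \<cdot> u)) \<in> M"
    using const_thread base u \<Gamma>_carrier[OF assms] by (simp add: M_def)
qed

text \<open>Among the powers of the parabolic element \<open>\<gamma> p \<gamma>\<inverse>\<close> of \<open>\<Gamma>\<close>, two lie in the same coset of the finite
index subgroup \<open>G n\<close>, and their quotient is a nontrivial power in \<open>G n\<close>.\<close>

lemma parabolic_in_G:
  assumes \<gamma>: "\<gamma> \<in> \<Gamma>"
  shows "\<exists>s. s \<noteq> 0 \<and> (\<gamma> \<cdot> u) \<cdot> horo_elt s \<cdot> inv\<^bsub>PSL2R\<^esub> (\<gamma> \<cdot> u) \<in> G n"
proof -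
  note [simp] = u horo_elt_in_carrier \<Gamma>_carrier[OF \<gamma>]
  let ?v = "\<gamma> \<cdot> u"
  let ?q = "\<lambda>k::nat. ?v \<cdot> horo_elt (k * T) \<cdot> inv\<^bsub>PSL2R\<^esub> ?v"
  have q: "?q k \<in> \<Gamma>" for k
  proof -
    have "u \<cdot> horo_elt (k * T) \<cdot> inv\<^bsub>PSL2R\<^esub> u \<in> \<Gamma>"
      using conj_period_in_\<Gamma> by (metis of_int_of_nat_eq)
    then have "\<gamma> \<cdot> (u \<cdot> horo_elt (k * T) \<cdot> inv\<^bsub>PSL2R\<^esub> u) \<cdot> inv\<^bsub>PSL2R\<^esub> \<gamma> \<in> \<Gamma>"
      using subgroup.m_closed[OF \<Gamma> subgroup.m_closed[OF \<Gamma> \<gamma>] subgroup.m_inv_closed[OF \<Gamma> \<gamma>]] by blast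
    then show ?thesis by (simp add: PSL.m_assoc PSL.inv_mult_group)
  qed
  have "range (\<lambda>k. G n \<diamondop> ?q k) \<subseteq> (\<lambda>\<gamma>. G n \<diamondop> \<gamma>) ` \<Gamma>" using q by blast
  then have "finite (range (\<lambda>k. G n \<diamondop> ?q k))" using G_finite_index finite_subset by blast
  then have "\<not> inj (\<lambda>k. G n \<diamondop> ?q k)" using finite_imageD infinite_UNIV_nat by blast
  then obtain i j where ij: "i \<noteq> j" "G n \<diamondop> ?q i = G n \<diamondop> ?q j" unfolding inj_on_def by blast
  then have "?q i \<cdot> inv\<^bsub>PSL2R\<^esub> ?q j \<in> G n"
    using PSL.rcoset_eq_iff[OF G[of n], of "?q i" "?q j"] by simp
  then have "?v \<cdot> horo_elt (i * T - j * T) \<cdot> inv\<^bsub>PSL2R\<^esub> ?v \<in> G n"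
    by (simp add: conj_horo_diff)
  moreover have "i * T - j * T \<noteq> 0" using ij(1) T_pos by simp
  ultimately show ?thesis by blast
qed

lemma boundary_orbit_\<Gamma>:
  assumes "\<gamma> \<in> \<Gamma>"
  shows "boundary_orbit \<Gamma> (forward_endpoint (\<gamma> \<cdot> u)) = boundary_orbit \<Gamma> (forward_endpoint u)"
  using fibre_thread(2)[OF assms] cusp_coset[of "\<gamma> \<cdot> u" 0] cusp_coset[of u 0] u \<Gamma>_carrier[OF assms]
  by (simp add: G_0 base_def)

lemma boundary_orbit_self:
  assumes "subgroup H PSL2R"
  shows "z \<in> boundary_orbit H z"
proof -
  have "moebius (mat 1) z = z" by (cases z) (simp_all add: moebius_def mat_def)
  then have "psl_act \<one>\<^bsub>PSL2R\<^esub> z = z" by (simp add: one_PSL2R psl_act_class)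
  then show ?thesis unfolding boundary_orbit_def using subgroup.one_closed[OF assms] by force
qed

text \<open>A cusp of \<open>G n\<close> over \<open>\<xi>\<close> is the orbit of a point of \<open>\<xi>\<close>, that is of the endpoint of some \<open>\<gamma> u\<close>. The converse
needs a parabolic element of \<open>G n\<close> fixing that endpoint, which \<open>parabolic_in_G\<close> provides.\<close>

lemma cusps_over_eq:
  "cusps_over (G n) \<Gamma> (boundary_orbit \<Gamma> (forward_endpoint u)) = cusps_at n"
  unfolding cusps_at_def
proof (rule equalityI; rule subsetI)
  fix C assume "C \<in> cusps_over (G n) \<Gamma> (boundary_orbit \<Gamma> (forward_endpoint u))"
  then obtain z where z: "C = boundary_orbit (G n) z"
      "cusp_proj \<Gamma> C = boundary_orbit \<Gamma> (forward_endpoint u)"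
    unfolding cusps_over_def cusps_def by blast
  have "z \<in> cusp_proj \<Gamma> C"
    unfolding cusp_proj_def z(1) using boundary_orbit_self[OF G] boundary_orbit_self[OF \<Gamma>] by blast
  then obtain \<gamma> where \<gamma>: "\<gamma> \<in> \<Gamma>" "z = psl_act \<gamma> (forward_endpoint u)"
    unfolding z(2) unfolding boundary_orbit_def by blast
  then have "C = cusp (G n \<diamondop> (\<gamma> \<cdot> u))"
    using u \<Gamma>_carrier by (simp add: z(1) cusp_coset forward_endpoint_mult)
  then show "C \<in> (\<lambda>y. cusp (y n)) ` M"
    using fibre_thread(1)[OF \<gamma>(1)] by (intro image_eqI[of _ _ "\<lambda>n. G n \<diamondop> (\<gamma> \<cdot> u)"])
next
  fix C assume "C \<in> (\<lambda>y. cusp (y n)) ` M"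
  then obtain y where y: "y \<in> M" "C = cusp (y n)" by blast
  then obtain s \<gamma> where \<gamma>: "\<gamma> \<in> \<Gamma>" "y n = G n \<diamondop> (\<gamma> \<cdot> u \<cdot> horo_elt s)"
    using M_coordinates by metis
  note [simp] = u horo_elt_in_carrier \<Gamma>_carrier[OF \<gamma>(1)]
  let ?v = "\<gamma> \<cdot> u"
  have C: "C = boundary_orbit (G n) (forward_endpoint ?v)"
    using y(2) \<gamma>(2) by (simp add: cusp_coset forward_endpoint_horo)
  obtain r where r: "r \<noteq> 0" "?v \<cdot> horo_elt r \<cdot> inv\<^bsub>PSL2R\<^esub> ?v \<in> G n"
    using parabolic_in_G[OF \<gamma>(1)] by blast
  have "psl_act (?v \<cdot> horo_elt r \<cdot> inv\<^bsub>PSL2R\<^esub> ?v) (forward_endpoint ?v) =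
      forward_endpoint (?v \<cdot> horo_elt r \<cdot> inv\<^bsub>PSL2R\<^esub> ?v \<cdot> ?v)"
    by (rule forward_endpoint_mult[symmetric]) simp_all
  also have "?v \<cdot> horo_elt r \<cdot> inv\<^bsub>PSL2R\<^esub> ?v \<cdot> ?v = ?v \<cdot> horo_elt r"
    using PSL.m_assoc[of "?v \<cdot> horo_elt r" "inv\<^bsub>PSL2R\<^esub> ?v" ?v] by simp
  also have "forward_endpoint (?v \<cdot> horo_elt r) = forward_endpoint ?v"
    by (rule forward_endpoint_horo) simp
  finally have "C \<in> cusps (G n)"
    unfolding C cusps_def using r parabolic_conjugate_horo[of ?v r] by fastforce
  moreover have "boundary_orbit \<Gamma> z = boundary_orbit \<Gamma> (forward_endpoint u)" if z: "z \<in> C" for z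
  proof -
    obtain g where g: "g \<in> G n" "z = psl_act g (forward_endpoint ?v)"
      using z unfolding C boundary_orbit_def by blast
    have "z = forward_endpoint (g \<cdot> \<gamma> \<cdot> u)"
      using \<Gamma>_carrier[OF G_\<Gamma>[OF g(1)]] by (simp add: g(2) PSL.m_assoc forward_endpoint_mult[symmetric])
    then show ?thesis
      using boundary_orbit_\<Gamma> subgroup.m_closed[OF \<Gamma> G_\<Gamma>[OF g(1)] \<gamma>(1)] by simp
  qed
  moreover have "C \<noteq> {}" unfolding C using boundary_orbit_self[OF G] by blast
  ultimately show "C \<in> cusps_over (G n) \<Gamma> (boundary_orbit \<Gamma> (forward_endpoint u))"
    unfolding cusps_over_def cusp_proj_def by auto
qed

lemma finite_cusps_at: "finite (cusps_at n)"
  unfolding cusps_at_def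
proof (rule finite_subset)
  show "(\<lambda>y. cusp (y n)) ` M \<subseteq> (\<lambda>C. cusp (C \<diamondop> u)) ` ((\<lambda>\<gamma>. G n \<diamondop> \<gamma>) ` \<Gamma>)"
  proof clarify
    fix y assume "y \<in> M"
    then obtain s \<gamma> where \<gamma>: "\<gamma> \<in> \<Gamma>" "y n = G n \<diamondop> (\<gamma> \<cdot> u \<cdot> horo_elt s)"
      using M_coordinates by metis
    have "cusp (y n) = cusp (G n \<diamondop> (\<gamma> \<cdot> u))"
      using \<gamma> u horo_elt_in_carrier \<Gamma>_carrier by (simp add: cusp_coset forward_endpoint_horo)
    also have "G n \<diamondop> (\<gamma> \<cdot> u) = G n \<diamondop> \<gamma> \<diamondop> u"
      using PSL.coset_mult_assoc[OF subgroup.subset[OF G]] u \<Gamma>_carrier[OF \<gamma>(1)] by simp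
    finally show "cusp (y n) \<in> (\<lambda>C. cusp (C \<diamondop> u)) ` ((\<lambda>\<gamma>. G n \<diamondop> \<gamma>) ` \<Gamma>)" using \<gamma>(1) by blast
  qed
  show "finite ((\<lambda>C. cusp (C \<diamondop> u)) ` ((\<lambda>\<gamma>. G n \<diamondop> \<gamma>) ` \<Gamma>))"
    using G_finite_index by blast
qed

section \<open>Minimal components\<close>

text \<open>A coordinate of a thread determines the earlier ones, so one coordinate does the work of an initial
segment.\<close>

lemma open_in_tower_coordinate:
  assumes "openin (tower_limit G) U" "z \<in> U"
  obtains n where "\<And>w. w \<in> topspace (tower_limit G) \<Longrightarrow> w n = z n \<Longrightarrow> w \<in> U"
proof -
  let ?X = "product_topology (\<lambda>n. T1 (G n)) UNIV"
  let ?L = "{y. \<forall>n. covering (G n) (y (Suc n)) = y n}"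
  obtain V where V: "openin ?X V" "U = V \<inter> ?L"
    using assms(1) unfolding tower_limit_def openin_subtopology by blast
  obtain n where n: "\<And>w. w \<in> topspace ?X \<Longrightarrow> \<forall>i<n. w i = z i \<Longrightarrow> w \<in> V"
    using openin_product_topology_initial_segment[OF V(1), of z] assms(2) V(2) by blast
  have z: "z \<in> topspace (tower_limit G)" using openin_subset[OF assms(1)] assms(2) by blast
  show thesis
  proof (rule that)
    fix w assume w: "w \<in> topspace (tower_limit G)" "w n = z n"
    have "\<forall>i<n. w i = z i" using thread_agree[OF w(1) z w(2)] by simp
    moreover have "w \<in> topspace ?X \<inter> ?L" using w(1) by (simp add: tower_limit_def)
    ultimately show "w \<in> U" using n V(2) by blast
  qed
qed

text \<open>Since a cusp at level \<open>n\<close> is an orbit at level \<open>n\<close>, these are the threads that follow the orbit of \<open>y\<close>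
at every level.\<close>

definition component :: "(nat \<Rightarrow> (real^2^2) set set) \<Rightarrow> (nat \<Rightarrow> (real^2^2) set set) set" where
  "component y = {z \<in> M. \<forall>n. cusp (z n) = cusp (y n)}"

definition transversal :: "(nat \<Rightarrow> (real^2^2) set set) \<Rightarrow> (nat \<Rightarrow> (real^2^2) set set) set" where
  "transversal y = {z \<in> component y. z 0 = base}"

lemma component_subset: "component y \<subseteq> topspace (tower_limit G)"
  by (auto simp: component_def M_def)

lemma limit_flow_M: "y \<in> M \<Longrightarrow> limit_flow s y \<in> M"
proof -
  assume y: "y \<in> M"
  then obtain t where t: "y 0 = horocycle_flow t base" by (auto simp: M_def flow_orbit_def)
  have "base \<in> topspace (T1 \<Gamma>)" unfolding base_def using coset_in_T1[of u 0] u by (simp add: G_0)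
  then have "horocycle_flow s (y 0) = horocycle_flow (s + t) base"
    by (simp add: t horocycle_flow_add[OF \<Gamma>])
  then show ?thesis
    using limit_flow_tower[OF M_tower[OF y]] by (auto simp: M_def limit_flow_def flow_orbit_def)
qed

lemma limit_flow_component: "z \<in> component y \<Longrightarrow> limit_flow s z \<in> component y"
proof -
  assume z: "z \<in> component y"
  then have zM: "z \<in> M" by (simp add: component_def)
  have "cusp (z n) = cusp (limit_flow s z n)" for n
    using cusp_eq_iff_same_orbit[OF zM limit_flow_M[OF zM]] by (auto simp: limit_flow_def)
  then show ?thesis using z limit_flow_M[OF zM] by (simp add: component_def)
qed

lemma component_eq_sweep: "component y = (\<lambda>(s, z). limit_flow s z) ` (UNIV \<times> transversal y)"
proof (rule equalityI; rule subsetI)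
  fix z assume z: "z \<in> component y"
  then have zt: "z \<in> topspace (tower_limit G)" using component_subset by blast
  obtain s where s: "z 0 = horocycle_flow s base"
    using z by (auto simp: component_def M_def flow_orbit_def)
  have bT: "base \<in> topspace (T1 \<Gamma>)" unfolding base_def using coset_in_T1[of u 0] u by (simp add: G_0)
  have "limit_flow (- s) z 0 = base"
    using horocycle_flow_add[OF \<Gamma> bT, of "- s" s] horocycle_flow_0[OF \<Gamma> bT]
    by (simp add: limit_flow_def s)
  then have "limit_flow (- s) z \<in> transversal y"
    using limit_flow_component[OF z] by (simp add: transversal_def)
  moreover have "z = limit_flow s (limit_flow (- s) z)"
    using limit_flow_add[OF zt, of s "- s"] limit_flow_0[OF zt] by simp
  ultimately show "z \<in> (\<lambda>(s, z). limit_flow s z) ` (UNIV \<times> transversal y)"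
    by (intro image_eqI[of _ _ "(s, limit_flow (- s) z)"]) auto
qed (auto simp: transversal_def limit_flow_component)

text \<open>These finite sets are the levels of the section \<open>transversal y\<close>: the points of \<open>T1 (G n)\<close> over the
base point that lie on the orbit of \<open>y n\<close>.\<close>

definition fibre :: "(nat \<Rightarrow> (real^2^2) set set) \<Rightarrow> nat \<Rightarrow> (real^2^2) set set set" where
  "fibre y n = {w \<in> topspace (T1 (G n)). covering \<Gamma> w = base \<and> cusp w = cusp (y n)}"

lemma fibre_representative:
  assumes "w \<in> fibre y n"
  obtains \<gamma> where "\<gamma> \<in> \<Gamma>" "w = G n \<diamondop> (\<gamma> \<cdot> u)"
proof -
  obtain v where v: "v \<in> carrier PSL2R" "w = G n \<diamondop> v"
    using assms unfolding fibre_def using T1_cases by blast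
  have "\<Gamma> \<diamondop> v = \<Gamma> \<diamondop> u"
    using assms covering_coset[OF \<Gamma> G G_subset v(1)] by (simp add: fibre_def v(2) base_def)
  then have "v \<in> \<Gamma> \<diamondop> u" using PSL.rcos_self[OF v(1) \<Gamma>] by simp
  then obtain \<gamma> where "\<gamma> \<in> \<Gamma>" "v = \<gamma> \<cdot> u" unfolding r_coset_def by blast
  then show thesis using that v(2) by blast
qed

lemma finite_fibre: "finite (fibre y n)"
proof (rule finite_subset)
  show "fibre y n \<subseteq> (\<lambda>C. C \<diamondop> u) ` ((\<lambda>\<gamma>. G n \<diamondop> \<gamma>) ` \<Gamma>)"
  proof
    fix w assume "w \<in> fibre y n"
    then obtain \<gamma> where \<gamma>: "\<gamma> \<in> \<Gamma>" "w = G n \<diamondop> (\<gamma> \<cdot> u)" by (rule fibre_representative)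
    have "w = G n \<diamondop> \<gamma> \<diamondop> u"
      unfolding \<gamma>(2)
      using PSL.coset_mult_assoc[OF subgroup.subset[OF G]] u \<Gamma>_carrier[OF \<gamma>(1)] by simp
    then show "w \<in> (\<lambda>C. C \<diamondop> u) ` ((\<lambda>\<gamma>. G n \<diamondop> \<gamma>) ` \<Gamma>)" using \<gamma>(1) by blast
  qed
qed (use G_finite_index in blast)

lemma covering_\<Gamma>_coordinate:
  assumes "z \<in> topspace (tower_limit G)"
  shows "covering \<Gamma> (z n) = z 0"
proof -
  have "z n \<in> topspace (T1 (G n))" using assms by (simp add: topspace_tower)
  then obtain v where v: "v \<in> carrier PSL2R" "z n = G n \<diamondop> v" by (rule T1_cases)
  then show ?thesis
    using thread_descends[OF assms v(2,1), of 0] covering_coset[OF \<Gamma> G G_subset v(1)]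
    by (simp add: G_0)
qed

lemma base_orbit: "base \<in> flow_orbit horocycle_flow base"
  using fibre_thread[OF subgroup.one_closed[OF \<Gamma>]] by (simp add: M_def)

lemma transversal_eq: "transversal y = topspace (tower_limit G) \<inter> PiE UNIV (fibre y)"
proof (rule equalityI; rule subsetI)
  fix z assume z: "z \<in> transversal y"
  then have zt: "z \<in> topspace (tower_limit G)" using component_subset by (auto simp: transversal_def)
  then show "z \<in> topspace (tower_limit G) \<inter> PiE UNIV (fibre y)"
    using z covering_\<Gamma>_coordinate[OF zt]
    by (auto simp: fibre_def transversal_def component_def topspace_tower PiE_UNIV_domain)
next
  fix z assume z: "z \<in> topspace (tower_limit G) \<inter> PiE UNIV (fibre y)"
  then have fib: "z n \<in> fibre y n" for n by (simp add: PiE_UNIV_domain Pi_iff)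
  have "z 0 = base" "\<And>n. cusp (z n) = cusp (y n)"
    using fib covering_\<Gamma>_coordinate[of z 0] z by (simp_all add: fibre_def)
  then show "z \<in> transversal y"
    using z base_orbit by (simp add: transversal_def component_def M_def)
qed

text \<open>The tower is closed in the product because the spaces \<open>T1 (G n)\<close> are Hausdorff, and the section is cut
out of it by a product of finite sets.\<close>

lemma compactin_transversal: "compactin (tower_limit G) (transversal y)"
proof -
  let ?X = "product_topology (\<lambda>n. T1 (G n)) UNIV"
  let ?L = "{y. \<forall>n. covering (G n) (y (Suc n)) = y n}"
  have "closedin ?X {z \<in> topspace ?X. covering (G n) (z (Suc n)) = z n}" for n
  proof (rule closedin_continuous_maps_eq[OF Hausdorff_T1])
    have proj: "continuous_map ?X (T1 (G m)) (\<lambda>z. z m)" for m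
      by (intro continuous_map_product_projection) simp
    show "continuous_map ?X (T1 (G n)) (\<lambda>z. z n)" by (rule proj)
    show "continuous_map ?X (T1 (G n)) (\<lambda>z. covering (G n) (z (Suc n)))"
      using continuous_map_compose[OF proj continuous_covering[OF G G G_decreasing]]
      by (simp add: o_def)
  qed
  then have "closedin ?X (\<Inter>n. {z \<in> topspace ?X. covering (G n) (z (Suc n)) = z n})"
    by (intro closedin_Inter) auto
  moreover have "(\<Inter>n. {z \<in> topspace ?X. covering (G n) (z (Suc n)) = z n}) = topspace (tower_limit G)"
    unfolding tower_limit_def by auto
  ultimately have closed: "closedin ?X (topspace (tower_limit G))" by simp
  have "compactin ?X (PiE UNIV (fibre y))"
    unfolding compactin_PiE using finite_fibre
    by (auto simp: fibre_def intro!: finite_imp_compactin)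
  then have "compactin ?X (transversal y)"
    unfolding transversal_eq by (rule closed_Int_compactin[OF closed])
  then show ?thesis
    unfolding tower_limit_def
    by (auto simp: compactin_subtopology transversal_eq tower_limit_def)
qed

text \<open>The flow moves the base point off itself except at its periods \<open>kT\<close>, and components are flow
invariant; hence the return times to the section are exactly the periods.\<close>

lemma suspension: "periodic_suspension (tower_limit G) limit_flow (transversal y) T"
proof (rule periodic_suspension.intro)
  fix z s assume z: "z \<in> transversal y"
  then have zc: "z \<in> component y" and z0: "z 0 = base" by (simp_all add: transversal_def)
  have "limit_flow s z \<in> transversal y \<longleftrightarrow> horocycle_flow s base = base"
    using limit_flow_component[OF zc] z0 by (simp add: transversal_def limit_flow_def)
  then show "limit_flow s z \<in> transversal y \<longleftrightarrow> (\<exists>k::int. s = k * T)"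
    by (simp add: T_period)
qed (fact Hausdorff_tower limit_flow_0 limit_flow_add continuous_limit_flow compactin_transversal T_pos)+

lemma component_eq_swept: "component y = periodic_suspension.swept limit_flow (transversal y)"
  unfolding component_eq_sweep periodic_suspension.swept_def[OF suspension]
    periodic_suspension.sweep_def[OF suspension] ..

text \<open>A proper closed invariant subset \<open>B\<close> would miss some \<open>z\<close> together with all threads that agree with \<open>z\<close>
at one level \<open>n\<close>. For \<open>b \<in> B\<close> the coordinates \<open>b n\<close> and \<open>z n\<close> lie on one orbit, so the flow carries
\<open>b\<close> to such a thread, contradicting invariance.\<close>

lemma minimal_component:
  assumes y: "y \<in> M"
  shows "minimal_set (tower_limit G) limit_flow (component y)"
  unfolding minimal_set_def
proof (intro conjI)
  have self: "y \<in> component y" using y by (simp add: component_def)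
  show "component y \<noteq> {}" using self by blast
  show "closedin (tower_limit G) (component y)"
    unfolding component_eq_swept
    using periodic_suspension.compactin_swept[OF suspension] Hausdorff_tower
    by (rule compactin_imp_closedin[rotated])
  show "flow_invariant limit_flow (component y)"
    using limit_flow_component by (auto simp: flow_invariant_def)
  show "\<nexists>B. B \<subset> component y \<and> B \<noteq> {} \<and> closedin (tower_limit G) B \<and> flow_invariant limit_flow B"
  proof
    assume "\<exists>B. B \<subset> component y \<and> B \<noteq> {} \<and> closedin (tower_limit G) B \<and> flow_invariant limit_flow B"
    then obtain B b z where B: "B \<subset> component y" "closedin (tower_limit G) B" "flow_invariant limit_flow B"
      and b: "b \<in> B" and z: "z \<in> component y" "z \<notin> B" by blast
    have bz: "b \<in> M" "z \<in> M" "\<And>n. cusp (b n) = cusp (z n)"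
      using B(1) b z(1) by (auto simp: component_def)
    have "openin (tower_limit G) (topspace (tower_limit G) - B)" using B(2) by blast
    then obtain n where n: "\<And>w. w \<in> topspace (tower_limit G) \<Longrightarrow> w n = z n \<Longrightarrow>
        w \<in> topspace (tower_limit G) - B"
      using open_in_tower_coordinate[of _ z] z component_subset by blast
    obtain r where "z n = horocycle_flow r (b n)"
      using cusp_eq_iff_same_orbit[OF bz(1,2)] bz(3) by blast
    then have "limit_flow r b \<notin> B"
      using n[OF limit_flow_tower[OF M_tower[OF bz(1)]]] by (auto simp: limit_flow_def)
    then show False using B(3) b by (auto simp: flow_invariant_def)
  qed
qed

end

section \<open>Counting components\<close>

text \<open>If \<open>g\<close> determines \<open>f\<close> on \<open>A\<close>, then \<open>f\<close> factors through \<open>g\<close>, and the factor is a surjection between the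
images; surjections between finite sets of equal size are injective.\<close>

lemma card_image_determined:
  assumes fin: "finite (g ` A)" and det: "\<And>a b. a \<in> A \<Longrightarrow> b \<in> A \<Longrightarrow> g a = g b \<Longrightarrow> f a = f b"
  shows "card (f ` A) \<le> card (g ` A)"
    and "card (f ` A) = card (g ` A) \<Longrightarrow> a \<in> A \<Longrightarrow> b \<in> A \<Longrightarrow> f a = f b \<Longrightarrow> g a = g b"
proof -
  define h where "h c = f (SOME a. a \<in> A \<and> g a = c)" for c
  have h: "h (g a) = f a" if "a \<in> A" for a
  proof -
    have "(SOME b. b \<in> A \<and> g b = g a) \<in> A \<and> g (SOME b. b \<in> A \<and> g b = g a) = g a"
      by (rule someI[of _ a]) (simp add: that)
    then show ?thesis unfolding h_def using det that by blast
  qed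
  have im: "f ` A = h ` (g ` A)" using h by (simp add: image_image)
  show "card (f ` A) \<le> card (g ` A)" unfolding im by (rule card_image_le[OF fin])
  assume "card (f ` A) = card (g ` A)" and ab: "a \<in> A" "b \<in> A" "f a = f b"
  then have "inj_on h (g ` A)" using fin unfolding im by (intro eq_card_imp_inj_on)
  then show "g a = g b"
    by (rule inj_onD) (use h ab in simp_all)
qed

context periodic_horocycle_tower
begin

lemma component_self: "y \<in> M \<Longrightarrow> y \<in> component y"
  by (simp add: component_def)

lemma Union_components: "\<Union> (component ` M) = M"
  using component_self by (auto simp: component_def)

lemma disjoint_components: "disjoint (component ` M)"
  unfolding disjoint_def component_def by auto

text \<open>The clopen sets that separate points prescribe one coordinate. For the absence of isolated points,
let \<open>z\<close> in the section be given by \<open>\<gamma>\<close> at level \<open>k\<close>, let \<open>G k\<close> be a proper subgroup of \<open>G m\<close>, and let \<open>g\<close> be in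
the difference. The thread of \<open>g \<gamma>\<close> agrees with \<open>z\<close> up to level \<open>m\<close> and differs from it at level \<open>k\<close>.
With \<open>m \<ge> N\<close>, agreement up to \<open>m\<close> keeps it in the component by the assumption on level \<open>N\<close>.\<close>

lemma homeomorphic_transversal_cantor_space:
  assumes y: "y \<in> M"
    and stable: "\<forall>a\<in>M. \<forall>b\<in>M. cusp (a N) = cusp (b N) \<longrightarrow> (\<forall>n. cusp (a n) = cusp (b n))"
    and proper: "\<forall>n. \<exists>k\<ge>n. G k \<noteq> G n"
  shows "subtopology (tower_limit G) (transversal y) homeomorphic_space cantor_space"
proof -
  let ?Z = "subtopology (tower_limit G) (transversal y)"
  define slice where "slice n w = {z \<in> transversal y. z n = w}" for n w
  have topZ: "topspace ?Z = transversal y"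
    using compactin_subset_topspace[OF compactin_transversal] by auto
  have fib: "z n \<in> fibre y n" if "z \<in> transversal y" for z n
    using that unfolding transversal_eq by (simp add: PiE_UNIV_domain Pi_iff)
  have closed: "closedin ?Z {z \<in> transversal y. z n \<in> W}" if "W \<subseteq> fibre y n" for n W
  proof -
    have "finite W" using that finite_fibre by (rule finite_subset)
    then have "closedin (T1 (G n)) W"
      using that by (intro closedin_Hausdorff_finite[OF Hausdorff_T1]) (auto simp: fibre_def)
    then have "closedin ?Z {z \<in> topspace ?Z. z n \<in> W}"
      by (rule closedin_continuous_map_preimage[OF
          continuous_map_from_subtopology[OF continuous_coordinate]])
    then show ?thesis by (simp only: topZ)
  qed
  show ?thesis
  proof (rule homeomorphic_cantor_space)
    show "compact_space ?Z" using compactin_transversal by (rule compact_space_subtopology)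
    show "\<exists>z. z \<in> topspace ?Z"
      using component_self[OF y] unfolding topZ component_eq_sweep by blast
    show "countable (\<Union>n. slice n ` fibre y n)"
      by (rule countable_UN) (simp_all add: countable_finite finite_fibre)
    show "openin ?Z b \<and> closedin ?Z b" if b: "b \<in> (\<Union>n. slice n ` fibre y n)" for b
    proof -
      obtain n w where w: "w \<in> fibre y n" "b = slice n w" using b by blast
      have "b = {z \<in> transversal y. z n \<in> {w}}" by (auto simp: w(2) slice_def)
      then have "closedin ?Z b" using closed[of "{w}" n] w(1) by simp
      moreover have "b = topspace ?Z - {z \<in> transversal y. z n \<in> fibre y n - {w}}"
        using fib unfolding topZ w(2) slice_def by blast
      then have "openin ?Z b" 
        using openin_diff[OF openin_topspace closed[of "fibre y n - {w}" n]] by (simp only: Diff_subset)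
      ultimately show ?thesis by blast
    qed
    show "\<exists>b\<in>(\<Union>n. slice n ` fibre y n). (z \<in> b) \<noteq> (z' \<in> b)"
      if "z \<in> topspace ?Z" "z' \<in> topspace ?Z" "z \<noteq> z'" for z z'
    proof -
      obtain n where "z n \<noteq> z' n" using \<open>z \<noteq> z'\<close> by blast
      then have "(z \<in> slice n (z n)) \<noteq> (z' \<in> slice n (z n))"
        using that topZ by (simp add: slice_def)
      moreover have "slice n (z n) \<in> (\<Union>n. slice n ` fibre y n)"
        using fib that(1) unfolding topZ by blast
      ultimately show ?thesis by blast
    qed
    show "\<exists>w\<in>U. w \<noteq> z" if U: "openin ?Z U" "z \<in> U" for U z
    proof -
      obtain V where V: "openin (tower_limit G) V" "U = V \<inter> transversal y"
        using U(1) unfolding openin_subtopology by blast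
      have z: "z \<in> transversal y" "z \<in> V" using U(2) V(2) by auto
      obtain n where n: "\<And>w. w \<in> topspace (tower_limit G) \<Longrightarrow> w n = z n \<Longrightarrow> w \<in> V"
        using open_in_tower_coordinate[OF V(1) z(2)] by blast
      define m where "m = max n N"
      obtain k where k: "k \<ge> m" "G k \<noteq> G m" using proper by blast
      then obtain g where g: "g \<in> G m" "g \<notin> G k" using G_antimono[OF k(1)] by blast
      obtain \<gamma> where \<gamma>: "\<gamma> \<in> \<Gamma>" "z k = G k \<diamondop> (\<gamma> \<cdot> u)"
        using fibre_representative[OF fib[OF z(1)]] by metis
      note [simp] = u \<Gamma>_carrier[OF \<gamma>(1)] \<Gamma>_carrier[OF G_\<Gamma>[OF g(1)]]
      have zM: "z \<in> M" and zc: "z \<in> component y"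
        using z(1) by (auto simp: transversal_def component_def)
      define w where "w j = G j \<diamondop> (g \<cdot> \<gamma> \<cdot> u)" for j
      have g\<gamma>: "g \<cdot> \<gamma> \<in> \<Gamma>" using \<Gamma> G_\<Gamma>[OF g(1)] \<gamma>(1) by (rule subgroup.m_closed)
      have wM: "w \<in> M" and w0: "w 0 = base" using fibre_thread[OF g\<gamma>] by (auto simp: w_def[abs_def])
      have "g \<cdot> \<gamma> \<cdot> u \<cdot> inv\<^bsub>PSL2R\<^esub> (\<gamma> \<cdot> u) = g"
        by (simp add: PSL.m_assoc)
      then have same_iff: "w j = G j \<diamondop> (\<gamma> \<cdot> u) \<longleftrightarrow> g \<in> G j" for j
        using PSL.rcoset_eq_iff[OF G[of j], of "g \<cdot> \<gamma> \<cdot> u" "\<gamma> \<cdot> u"] by (simp add: w_def)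
      have wm: "w m = z m"
        using same_iff g(1) thread_descends[OF M_tower[OF zM] \<gamma>(2) _ k(1)] by simp
      have "w k \<noteq> z k" using same_iff g(2) \<gamma>(2) by simp
      then have "w \<noteq> z" by blast
      have agree: "w j = z j" if "j \<le> m" for j
        using thread_agree[OF M_tower[OF wM] M_tower[OF zM] wm that] .
      have "w \<in> V" using n M_tower[OF wM] agree by (simp add: m_def)
      moreover have "cusp (w N) = cusp (z N)" using agree[of N] by (simp add: m_def)
      then have "cusp (w j) = cusp (z j)" for j
        using stable wM zM by blast
      then have "w \<in> transversal y"
        using wM w0 zc by (simp add: transversal_def component_def)
      ultimately show ?thesis using V(2) \<open>w \<noteq> z\<close> by blast
    qed
  qed
qed

lemma solenoid_component:
  assumes "y \<in> M"
    and "\<forall>a\<in>M. \<forall>b\<in>M. cusp (a N) = cusp (b N) \<longrightarrow> (\<forall>n. cusp (a n) = cusp (b n))"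
    and "\<forall>n. \<exists>k\<ge>n. G k \<noteq> G n"
  shows "one_dim_solenoid (subtopology (tower_limit G) (component y))"
  unfolding component_eq_swept
  using homeomorphic_transversal_cantor_space[OF assms]
  by (rule periodic_suspension.one_dim_solenoid_swept[OF suspension])

lemma cusp_count_mono: "m \<le> n \<Longrightarrow> card (cusps_at m) \<le> card (cusps_at n)"
  unfolding cusps_at_def
  by (rule card_image_determined(1)[OF finite_cusps_at[unfolded cusps_at_def]]) (rule cusp_descends)

text \<open>The cusp at a level determines the cusps below it. Beyond \<open>N\<close> the resulting surjections between finite
sets of equal size are injective.\<close>

lemma stable_if_maximal:
  assumes max: "\<And>n. card (cusps_at n) \<le> card (cusps_at N)"
    and ab: "a \<in> M" "b \<in> M" "cusp (a N) = cusp (b N)"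
  shows "cusp (a n) = cusp (b n)"
proof (cases "n \<le> N")
  case True
  then show ?thesis using cusp_descends ab by blast
next
  case False
  then have "N \<le> n" by simp
  then have "card (cusps_at N) = card (cusps_at n)"
    using max cusp_count_mono by (meson antisym)
  then have card_eq: "card ((\<lambda>y. cusp (y N)) ` M) = card ((\<lambda>y. cusp (y n)) ` M)"
    by (simp only: cusps_at_def)
  show ?thesis
  proof (rule card_image_determined(2)[where f = "\<lambda>y. cusp (y N)" and g = "\<lambda>y. cusp (y n)" and A = M])
    fix a b assume "a \<in> M" "b \<in> M" "cusp (a n) = cusp (b n)"
    then show "cusp (a N) = cusp (b N)" using \<open>N \<le> n\<close> by (rule cusp_descends)
  qed (fact finite_cusps_at[unfolded cusps_at_def] card_eq ab)+
qed

lemma component_eq_iff: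
  assumes "y \<in> M" "z \<in> M"
  shows "component y = component z \<longleftrightarrow> (\<forall>n. cusp (y n) = cusp (z n))"
proof
  assume "component y = component z"
  then show "\<forall>n. cusp (y n) = cusp (z n)"
    using component_self[OF assms(1)] by (simp add: component_def)
qed (simp add: component_def)

lemma card_components:
  assumes max: "\<And>n. card (cusps_at n) \<le> card (cusps_at N)"
  shows "finite (component ` M)" "card (component ` M) = card (cusps_at N)"
proof -
  have det: "component a = component b" if "a \<in> M" "b \<in> M" "cusp (a N) = cusp (b N)" for a b
    using stable_if_maximal[OF max that] component_eq_iff that by blast
  have fin: "finite ((\<lambda>y. cusp (y N)) ` M)"
    using finite_cusps_at unfolding cusps_at_def .
  show finite: "finite (component ` M)"
  proof (rule finite_surj[OF fin])
    show "component ` M \<subseteq> (\<lambda>C. {z \<in> M. cusp (z N) = C}) ` (\<lambda>y. cusp (y N)) ` M"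
    proof
      fix K assume "K \<in> component ` M"
      then obtain y where y: "y \<in> M" "K = component y" by blast
      have "component y = {z \<in> M. cusp (z N) = cusp (y N)}"
        using stable_if_maximal[OF max] y(1) unfolding component_def by blast
      then show "K \<in> (\<lambda>C. {z \<in> M. cusp (z N) = C}) ` (\<lambda>y. cusp (y N)) ` M"
        using y by blast
    qed
  qed
  show "card (component ` M) = card (cusps_at N)"
  proof (rule antisym)
    show "card (component ` M) \<le> card (cusps_at N)"
      unfolding cusps_at_def by (rule card_image_determined(1)[OF fin det])
    show "card (cusps_at N) \<le> card (component ` M)"
      unfolding cusps_at_def by (rule card_image_determined(1)[OF finite]) (simp add: component_eq_iff)
  qed
qed

text \<open>Every component has a single cusp at each level, so there are at least as many components as cusps
at any level.\<close>

lemma infinite_components: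
  assumes "\<not> bdd_above (range (\<lambda>n. card (cusps_at n)))"
  shows "infinite (component ` M)"
proof
  assume fin: "finite (component ` M)"
  have "card (cusps_at n) \<le> card (component ` M)" for n
    unfolding cusps_at_def
    by (rule card_image_determined(1)[OF fin]) (simp add: component_eq_iff)
  then show False using assms by (auto simp: bdd_above_def)
qed

end

theorem theorem2:
  fixes \<Gamma> :: "(real^2^2) set set"
    and G :: "nat \<Rightarrow> (real^2^2) set set"
    and x :: "(real^2^2) set set"
    and u :: "(real^2^2) set"
    and \<xi> :: "real option set"
    and c :: "nat \<Rightarrow> nat"
    and Y :: "(nat \<Rightarrow> (real^2^2) set set) topology"
    and M :: "(nat \<Rightarrow> (real^2^2) set set) set"
  assumes lattice: "nonuniform_lattice \<Gamma>"
    and torsion_free: "torsion_free \<Gamma>"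
    and G_0: "G 0 = \<Gamma>"
    and G_subgroup: "\<And>n. subgroup (G n) (PSL2R\<lparr>carrier := \<Gamma>\<rparr>)"
    and G_decreasing: "\<And>n. G (Suc n) \<subseteq> G n"
    and G_finite_index: "\<And>n. finite (rcosets\<^bsub>PSL2R\<lparr>carrier := \<Gamma>\<rparr>\<^esub> (G n))"
    and G_index: "filterlim (\<lambda>n. card (rcosets\<^bsub>PSL2R\<lparr>carrier := \<Gamma>\<rparr>\<^esub> (G n))) at_top sequentially"
    and u: "u \<in> carrier PSL2R"
    and x: "x = \<Gamma> #>\<^bsub>PSL2R\<^esub> u"
    and periodic: "horo_periodic x"
    and \<xi>: "\<xi> = boundary_orbit \<Gamma> (forward_endpoint u)"
    and c: "\<And>n. c n = card (cusps_over (G n) \<Gamma> \<xi>)"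
    and Y: "Y = tower_limit G"
    and M: "M = {y \<in> topspace Y. y 0 \<in> flow_orbit horocycle_flow x}"
  shows "(\<forall>n. c n \<le> c (Suc n)) \<and>
    ((\<forall>n. c n = 1) \<longrightarrow> one_dim_solenoid (subtopology Y M) \<and> minimal_set Y limit_flow M) \<and>
    (\<forall>m. m \<in> range c \<and> (\<forall>n. c n \<le> m) \<longrightarrow>
      (\<exists>F. finite F \<and> card F = m \<and> disjoint F \<and> \<Union>F = M \<and>
           (\<forall>N\<in>F. one_dim_solenoid (subtopology Y N) \<and> minimal_set Y limit_flow N))) \<and>
    (\<not> bdd_above (range c) \<longrightarrow>
      (\<exists>F. infinite F \<and> disjoint F \<and> \<Union>F = M \<and> (\<forall>N\<in>F. minimal_set Y limit_flow N)))"
proof -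
  have \<Gamma>: "subgroup \<Gamma> PSL2R" and discrete: "subtopology PSL2R_top \<Gamma> = discrete_topology \<Gamma>"
    using lattice by (simp_all add: nonuniform_lattice_def lattice_subgroup_def)
  have index: "rcosets\<^bsub>PSL2R\<lparr>carrier := \<Gamma>\<rparr>\<^esub> H = (\<lambda>\<gamma>. H #>\<^bsub>PSL2R\<^esub> \<gamma>) ` \<Gamma>" for H
    by (auto simp: RCOSETS_def r_coset_def)
  interpret tower: periodic_horocycle_tower \<Gamma> G u
  proof (rule periodic_horocycle_tower.intro)
    show "subgroup (G n) PSL2R" for n
      using PSL.incl_subgroup[OF \<Gamma> G_subgroup] .
    show "finite ((\<lambda>\<gamma>. G n #>\<^bsub>PSL2R\<^esub> \<gamma>) ` \<Gamma>)" for n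
      using G_finite_index unfolding index .
    show "horo_periodic (\<Gamma> #>\<^bsub>PSL2R\<^esub> u)" using periodic x by simp
  qed (fact \<Gamma> discrete G_0 G_decreasing u)+
  have M_eq: "M = tower.M"
    unfolding M Y tower.M_def tower.base_def x ..
  have c_eq: "c n = card (tower.cusps_at n)" for n
    unfolding c \<xi> tower.cusps_over_eq ..
  have proper: "\<exists>k\<ge>n. G k \<noteq> G n" for n
  proof -
    have "eventually (\<lambda>k. card (rcosets\<^bsub>PSL2R\<lparr>carrier := \<Gamma>\<rparr>\<^esub> (G n)) <
        card (rcosets\<^bsub>PSL2R\<lparr>carrier := \<Gamma>\<rparr>\<^esub> (G k))) sequentially"
      using G_index[unfolded filterlim_at_top, rule_format,
          of "Suc (card (rcosets\<^bsub>PSL2R\<lparr>carrier := \<Gamma>\<rparr>\<^esub> (G n)))"]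
      by (simp only: Suc_le_eq)
    then obtain k0 where "\<And>k. k \<ge> k0 \<Longrightarrow> card (rcosets\<^bsub>PSL2R\<lparr>carrier := \<Gamma>\<rparr>\<^esub> (G n)) <
        card (rcosets\<^bsub>PSL2R\<lparr>carrier := \<Gamma>\<rparr>\<^esub> (G k))"
      unfolding eventually_sequentially by blast
    then have "G (max n k0) \<noteq> G n" by (metis max.cobounded2 less_irrefl)
    then show ?thesis by (intro exI[of _ "max n k0"]) simp
  qed
  have minimal: "\<forall>N\<in>tower.component ` M. minimal_set Y limit_flow N"
    unfolding M_eq Y using tower.minimal_component by blast
  have bounded: "\<exists>F. finite F \<and> card F = m \<and> disjoint F \<and> \<Union>F = M \<and>
           (\<forall>N\<in>F. one_dim_solenoid (subtopology Y N) \<and> minimal_set Y limit_flow N)"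
    if m: "m \<in> range c" "\<forall>n. c n \<le> m" for m
  proof -
    obtain n0 where n0: "m = c n0" using m(1) by blast
    have max: "card (tower.cusps_at n) \<le> card (tower.cusps_at n0)" for n
      using m(2) n0 c_eq by simp
    have "\<forall>N\<in>tower.component ` M. one_dim_solenoid (subtopology Y N)"
      unfolding M_eq Y
    proof
      fix K assume "K \<in> tower.component ` tower.M"
      then obtain y where "y \<in> tower.M" "K = tower.component y" by blast
      moreover have "\<forall>a\<in>tower.M. \<forall>b\<in>tower.M. tower.cusp (a n0) = tower.cusp (b n0) \<longrightarrow>
          (\<forall>n. tower.cusp (a n) = tower.cusp (b n))"
        using tower.stable_if_maximal[OF max] by blast
      ultimately show "one_dim_solenoid (subtopology (tower_limit G) K)"
        using tower.solenoid_component proper by blast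
    qed
    then show ?thesis
      using minimal tower.card_components[OF max] tower.disjoint_components tower.Union_components
      by (intro exI[of _ "tower.component ` M"]) (simp add: M_eq n0 c_eq)
  qed
  have "one_dim_solenoid (subtopology Y M) \<and> minimal_set Y limit_flow M" if c1: "\<forall>n. c n = 1"
  proof -
    have "1 \<in> range c" "\<forall>n. c n \<le> 1" using c1 by (auto intro: range_eqI[of _ _ 0])
    then obtain F where F: "card F = 1" "\<Union>F = M"
        "\<forall>N\<in>F. one_dim_solenoid (subtopology Y N) \<and> minimal_set Y limit_flow N"
      using bounded by blast
    then obtain N where "F = {N}" using card_1_singletonE by blast
    then show ?thesis using F by simp
  qed
  moreover have "c n \<le> c (Suc n)" for n
    unfolding c_eq by (rule tower.cusp_count_mono) simp
  moreover have "\<exists>F. infinite F \<and> disjoint F \<and> \<Union>F = M \<and> (\<forall>N\<in>F. minimal_set Y limit_flow N)"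
    if "\<not> bdd_above (range c)"
  proof -
    have "range c = range (\<lambda>n. card (tower.cusps_at n))" using c_eq by auto
    then have "infinite (tower.component ` M)"
      using tower.infinite_components that unfolding M_eq by simp
    then show ?thesis
      using minimal tower.disjoint_components tower.Union_components
      by (intro exI[of _ "tower.component ` M"]) (simp add: M_eq)
  qed
  ultimately show ?thesis using bounded by blast
qed

end
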